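(* If $W_1,W_2\in\mathrm{Hom}_{C(X)}(S,\Xi)$, then $$R(W_1^*W_2)=(MW_1)^*\,MW_2 .$$ In particular, if $MW_1=W_1$ and $MW_2=W_2$, then $R(W_1^*W_2)=W_1^*W_2$, i.e., $W_1^*W_2$ is harmonic.
   Context: Geometric setting. $\tilde X$ is a locally compact metric space with metric $\mathrm{dist}$; a discrete group $G$ acts on $\tilde X$ isometrically and properly discontinuously (freely, so that the quotient map is a covering map); $X:=\tilde X/G$ is compact, $p:\tilde X\to X$ is the quotient covering map. $\tilde r:\tilde X\to\tilde X$ is a homeomorphism such that for some $0<\theta<1$, $\mathrm{dist}(x,y)\le\theta\,\mathrm{dist}(\tilde rx,\tilde ry)$ for all $x,y$. There is $A\in\mathrm{End}(G)$ with $AG$ a normal subgroup of $G$ and $\tilde r(gx)=(Ag)\tilde r(x)$ for all $g\in G$, $x\in\tilde X$. $r:X\to X$ is defined by $r(p(x))=p(\tilde r(x))$. $g_1=1,g_2,\dots,g_q$ is a (finite) complete system of representatives of the right cosets of $AG$ in $G$, and $\psi_i=\tilde r^{-1}\circ g_i$; thus $\{p\psi_1x,\dots,p\psi_qx\}=r^{-1}(px)$. Bundle. $\xi\to X$ is a Lipschitz continuous $d$-dimensional complex vector bundle with a hermitian metric $\langle\cdot,\cdot\rangle$ (conjugate linear in the first variable); $S$ is the $C(X)$-Hilbert module of continuous sections with the pointwise inner product; $\mathrm{End}(\xi)$ is the $C^*$-algebra of continuous bundle maps $\xi\to\xi$ over the identity, identified with the $C(X)$-endomorphisms of $S$ via $(Fs)(x)=F(x)s(x)$.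 The pullback $p^*\xi$ is assumed trivial and is identified fiberwise isometrically with $\tilde X\times\mathbb C^d$. Transfer operator. $m:r^*\xi\to\xi$ is a bundle map, i.e. linear maps $m(y):\xi_{r(y)}\to\xi_y$, with adjoint $m^*(y):\xi_y\to\xi_{r(y)}$. The transfer operator $R$ acts on $h\in\mathrm{End}(\xi)$ by $(Rh)(px)=\sum_{i=1}^q m^*(p\psi_ix)h(p\psi_ix)m(p\psi_ix)$, $x\in\tilde X$; $h$ is harmonic if $Rh=h$. Standing assumptions: $m$ is Lipschitz continuous and $\sup_k\|R^k\|_\infty<\infty$ (operator norm for the sup norm on $\mathrm{End}(\xi)$). Refinement operator. $\Xi$ is the set of bounded continuous $f:\tilde X\to\mathbb C$ such that $x\mapsto\sum_{g\in G}|f(gx)|^2$ is bounded and continuous; it is a $C(X)$-Hilbert module ($C(X)$ acting by multiplication with $a\circ p$) with the inner product $\langle f_1,f_2\rangle'=\sum_{g\in G}\overline{f_1\circ g}\;f_2\circ g$ (a $G$-invariant function, viewed as a function on $X$). $\mathrm{Hom}_{C(X)}(S,\Xi)$ is the set of adjointable $C(X)$-linear maps $S\to\Xi$; $W^*$ is the Hilbert module adjoint. The refinement operator $M$ on $\mathrm{Hom}_{C(X)}(S,\Xi)$ is $(MW)s=\big(W(m\,s\circ r)\big)\circ\tilde r^{-1}$ for $s\in S$, where $m\,s\circ r\in S$ is the section $y\mapsto m(y)s(r(y))$. *)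

theory Defs
  imports "HOL-Analysis.Analysis" "HOL-Algebra.Group_Action"
begin

section \<open>The self-covering of the quotient space\<close>

text \<open>
  The space upstairs is the type \<open>'a\<close>. The quotient \<open>X\<close> is a type \<open>'x\<close> together with a surjection
  \<open>p\<close> whose fibres are the orbits; its metric is the quotient metric, the distance of orbits
  (positive for distinct orbits since \<open>G\<close> acts by isometries, freely and properly
  discontinuously). This metric induces the quotient topology and makes \<open>p\<close> a covering map.
  \<open>G\<close> is discrete, so it carries no topology.
\<close>

locale self_covering =
  fixes G :: "('g, 'b) monoid_scheme"
    and act :: "'g \<Rightarrow> 'a::metric_space \<Rightarrow> 'a"
    and p :: "'a \<Rightarrow> 'x::metric_space"
    and A :: "'g \<Rightarrow> 'g"
    and rt :: "'a \<Rightarrow> 'a"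
    and r :: "'x \<Rightarrow> 'x"
    and q :: nat
    and gs :: "nat \<Rightarrow> 'g"
  assumes locally_compact: "locally compact (UNIV :: 'a set)"
    and action: "group_action G UNIV act"
    and isometric: "\<And>g x y. g \<in> carrier G \<Longrightarrow> dist (act g x) (act g y) = dist x y"
    and free: "\<And>g x. g \<in> carrier G \<Longrightarrow> act g x = x \<Longrightarrow> g = \<one>\<^bsub>G\<^esub>"
    and properly_discontinuous:
      "\<And>K. compact K \<Longrightarrow> finite {g \<in> carrier G. act g ` K \<inter> K \<noteq> {}}"
    and p_surj: "surj p"
    and p_orbit: "\<And>x y. p x = p y \<longleftrightarrow> (\<exists>g\<in>carrier G. y = act g x)"
    and p_dist: "\<And>x y. dist (p x) (p y) = (INF g\<in>carrier G. dist x (act g y))"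
    and compact_quotient: "compact (UNIV :: 'x set)"
    and rt_homeomorphism: "homeomorphism UNIV UNIV rt (inv_into UNIV rt)"
    and rt_expanding: "\<exists>\<theta>. 0 < \<theta> \<and> \<theta> < 1 \<and> (\<forall>x y. dist x y \<le> \<theta> * dist (rt x) (rt y))"
    and A_hom: "A \<in> hom G G"
    and A_normal: "normal (A ` carrier G) G"
    and rt_equivariant: "\<And>g x. g \<in> carrier G \<Longrightarrow> rt (act g x) = act (A g) (rt x)"
    and r_p: "\<And>x. r (p x) = p (rt x)"
    and gs_carrier: "\<And>i. i \<in> {1..q} \<Longrightarrow> gs i \<in> carrier G"
    and gs_1: "gs 1 = \<one>\<^bsub>G\<^esub>"
    and gs_representatives:
      "bij_betw (\<lambda>i. (A ` carrier G) #>\<^bsub>G\<^esub> gs i) {1..q} (rcosets\<^bsub>G\<^esub> (A ` carrier G))"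

definition psi :: "('g \<Rightarrow> 'a \<Rightarrow> 'a) \<Rightarrow> ('a \<Rightarrow> 'a) \<Rightarrow> (nat \<Rightarrow> 'g) \<Rightarrow> nat \<Rightarrow> 'a \<Rightarrow> 'a"
  where "psi act rt gs i x = inv_into UNIV rt (act (gs i) x)"


section \<open>Lipschitz vector bundles with a hermitian metric\<close>

text \<open>
  The fibres are subspaces of a complex vector space \<open>'v\<close>; this is no restriction, as any family of
  vector spaces embeds into its direct sum. The ambient space only supplies the fibrewise linear
  operations: the topology of the total space \<open>{(y, v). v \<in> fiber \<xi> y}\<close> is part of the data and is
  not induced from \<open>'v\<close>. A chart \<open>(U, \<phi>)\<close> is a local trivialization over \<open>U\<close>, given fibrewise by
  \<open>\<phi> y : fiber \<xi> y \<rightarrow> \<complex>\<^sup>d\<close>; the chosen atlas defines the Lipschitz structure. The rank is \<open>CARD('d)\<close>.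
\<close>

record ('x, 'v, 'd) vbundle =
  scl :: "complex \<Rightarrow> 'v \<Rightarrow> 'v"
  total :: "('x \<times> 'v) topology"
  charts :: "('x set \<times> ('x \<Rightarrow> 'v \<Rightarrow> complex ^ 'd)) set"
  herm :: "'x \<Rightarrow> 'v \<Rightarrow> 'v \<Rightarrow> complex"

definition fiber :: "('x, 'v, 'd::finite) vbundle \<Rightarrow> 'x \<Rightarrow> 'v set"
  where "fiber \<xi> y = {v. (y, v) \<in> topspace (total \<xi>)}"

definition linear_between ::
    "(complex \<Rightarrow> 'v \<Rightarrow> 'v::ab_group_add) \<Rightarrow> 'v set \<Rightarrow> (complex \<Rightarrow> 'w \<Rightarrow> 'w::ab_group_add) \<Rightarrow> 'w set
      \<Rightarrow> ('v \<Rightarrow> 'w) \<Rightarrow> bool"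
  where "linear_between s1 V s2 W T \<longleftrightarrow>
    T \<in> V \<rightarrow> W \<and> (\<forall>u\<in>V. \<forall>v\<in>V. T (u + v) = T u + T v) \<and> (\<forall>c. \<forall>v\<in>V. T (s1 c v) = s2 c (T v))"

text \<open>Lipschitz continuity in charts is understood locally. As the base is compact, this amounts to
  Lipschitz continuity after shrinking the domains of the charts.\<close>

definition locally_lipschitz_on :: "'x::metric_space set \<Rightarrow> ('x \<Rightarrow> 'c::metric_space) \<Rightarrow> bool"
  where "locally_lipschitz_on U f \<longleftrightarrow> (\<forall>y\<in>U. \<exists>e>0. \<exists>L. L-lipschitz_on (ball y e \<inter> U) f)"

definition lipschitz_vector_bundle ::
    "('x::metric_space, 'v::ab_group_add, 'd::finite) vbundle \<Rightarrow> bool"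
  where "lipschitz_vector_bundle \<xi> \<longleftrightarrow>
    vector_space (scl \<xi>) \<and>
    (\<forall>y. module.subspace (scl \<xi>) (fiber \<xi> y)) \<and>
    continuous_map (total \<xi>) euclidean fst \<and>
    \<Union> (fst ` charts \<xi>) = UNIV \<and>
    (\<forall>(U, \<phi>) \<in> charts \<xi>.
      open U \<and>
      (\<forall>y\<in>U. linear_between (scl \<xi>) (fiber \<xi> y) (*s) UNIV (\<phi> y) \<and>
              bij_betw (\<phi> y) (fiber \<xi> y) UNIV) \<and>
      homeomorphic_map (subtopology (total \<xi>) (U \<times> UNIV)) (top_of_set (U \<times> UNIV))
        (\<lambda>(y, v). (y, \<phi> y v))) \<and>
    (\<forall>(U, \<phi>) \<in> charts \<xi>. \<forall>(V, \<psi>) \<in> charts \<xi>.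
      locally_lipschitz_on (U \<inter> V) (\<lambda>y. matrix (\<phi> y \<circ> inv_into (fiber \<xi> y) (\<psi> y))))"

definition hermitian_metric :: "('x::topological_space, 'v::ab_group_add, 'd::finite) vbundle \<Rightarrow> bool"
  where "hermitian_metric \<xi> \<longleftrightarrow>
    (\<forall>y. \<forall>u\<in>fiber \<xi> y. linear_between (scl \<xi>) (fiber \<xi> y) (*) UNIV (herm \<xi> y u)) \<and>
    (\<forall>y. \<forall>u\<in>fiber \<xi> y. \<forall>v\<in>fiber \<xi> y. herm \<xi> y v u = cnj (herm \<xi> y u v)) \<and>
    (\<forall>y. \<forall>v\<in>fiber \<xi> y. v \<noteq> 0 \<longrightarrow> 0 < Re (herm \<xi> y v v)) \<and>
    continuous_map (subtopology (prod_topology (total \<xi>) (total \<xi>)) {(e, e'). fst e = fst e'}) euclidean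
      (\<lambda>((y, u), (_, v)). herm \<xi> y u v)"

text \<open>Total space of the pullback along \<open>f\<close>, as a subspace of a product.\<close>

definition pullback ::
    "('x, 'v, 'd::finite) vbundle \<Rightarrow> ('y::topological_space \<Rightarrow> 'x) \<Rightarrow> ('y \<times> 'x \<times> 'v) topology"
  where "pullback \<xi> f = subtopology (prod_topology euclidean (total \<xi>)) {(x, y, v). y = f x}"

definition isometrically_trivial_pullback ::
    "('x, 'v::ab_group_add, 'd::finite) vbundle \<Rightarrow> ('y::topological_space \<Rightarrow> 'x) \<Rightarrow> bool"
  where "isometrically_trivial_pullback \<xi> f \<longleftrightarrow>
    (\<exists>\<tau> :: 'y \<Rightarrow> 'v \<Rightarrow> complex ^ 'd.
      (\<forall>x. linear_between (scl \<xi>) (fiber \<xi> (f x)) (*s) UNIV (\<tau> x) \<and>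
           bij_betw (\<tau> x) (fiber \<xi> (f x)) UNIV \<and>
           (\<forall>u\<in>fiber \<xi> (f x). \<forall>v\<in>fiber \<xi> (f x).
              herm \<xi> (f x) u v = (\<Sum>j\<in>UNIV. cnj (\<tau> x u $ j) * \<tau> x v $ j))) \<and>
      homeomorphic_map (pullback \<xi> f) euclidean (\<lambda>(x, _, v). (x, \<tau> x v)))"

text \<open>A bundle map from the pullback of \<open>\<xi>\<close> along \<open>r\<close> to \<open>\<xi>\<close> over the identity: a family of
  linear maps \<open>m y : fiber \<xi> (r y) \<rightarrow> fiber \<xi> y\<close>.\<close>

definition lipschitz_bundle_map ::
    "('x::metric_space, 'v::ab_group_add, 'd::finite) vbundle \<Rightarrow> ('x \<Rightarrow> 'x) \<Rightarrow> ('x \<Rightarrow> 'v \<Rightarrow> 'v) \<Rightarrow> bool"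
  where "lipschitz_bundle_map \<xi> r m \<longleftrightarrow>
    (\<forall>y. linear_between (scl \<xi>) (fiber \<xi> (r y)) (scl \<xi>) (fiber \<xi> y) (m y)) \<and>
    continuous_map (pullback \<xi> r) (total \<xi>) (\<lambda>(y, _, v). (y, m y v)) \<and>
    (\<forall>(U, \<phi>) \<in> charts \<xi>. \<forall>(V, \<psi>) \<in> charts \<xi>.
      locally_lipschitz_on {y \<in> V. r y \<in> U}
        (\<lambda>y. matrix (\<psi> y \<circ> m y \<circ> inv_into (fiber \<xi> (r y)) (\<phi> (r y)))))"

definition bundle_map_adjoint ::
    "('x, 'v, 'd::finite) vbundle \<Rightarrow> ('x \<Rightarrow> 'x) \<Rightarrow> ('x \<Rightarrow> 'v \<Rightarrow> 'v) \<Rightarrow> 'x \<Rightarrow> 'v \<Rightarrow> 'v"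
  where "bundle_map_adjoint \<xi> r m y w =
    (THE v. v \<in> fiber \<xi> (r y) \<and> (\<forall>u\<in>fiber \<xi> (r y). herm \<xi> y (m y u) w = herm \<xi> (r y) u v))"


section \<open>Sections and endomorphisms\<close>

definition sections :: "('x::topological_space, 'v, 'd::finite) vbundle \<Rightarrow> ('x \<Rightarrow> 'v) set"
  where "sections \<xi> = {s. continuous_map euclidean (total \<xi>) (\<lambda>y. (y, s y))}"

definition sec_inner :: "('x, 'v, 'd::finite) vbundle \<Rightarrow> ('x \<Rightarrow> 'v) \<Rightarrow> ('x \<Rightarrow> 'v) \<Rightarrow> 'x \<Rightarrow> complex"
  where "sec_inner \<xi> s t y = herm \<xi> y (s y) (t y)"

text \<open>Fibre maps are extensional, so that equality of endomorphisms is equality of functions.\<close>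

definition bundle_End :: "('x, 'v::ab_group_add, 'd::finite) vbundle \<Rightarrow> ('x \<Rightarrow> 'v \<Rightarrow> 'v) set"
  where "bundle_End \<xi> = {h.
    (\<forall>y. h y \<in> extensional (fiber \<xi> y) \<and>
         linear_between (scl \<xi>) (fiber \<xi> y) (scl \<xi>) (fiber \<xi> y) (h y)) \<and>
    continuous_map (total \<xi>) (total \<xi>) (\<lambda>(y, v). (y, h y v))}"

text \<open>The identification of \<open>C(X)\<close>-linear operators on sections with bundle endomorphisms.\<close>

definition endo_of ::
    "('x::topological_space, 'v::ab_group_add, 'd::finite) vbundle
      \<Rightarrow> (('x \<Rightarrow> 'v) \<Rightarrow> ('x \<Rightarrow> 'v)) \<Rightarrow> ('x \<Rightarrow> 'v \<Rightarrow> 'v)"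
  where "endo_of \<xi> F = (THE h. h \<in> bundle_End \<xi> \<and> (\<forall>s\<in>sections \<xi>. \<forall>y. F s y = h y (s y)))"

definition vnorm :: "('x, 'v, 'd::finite) vbundle \<Rightarrow> 'x \<Rightarrow> 'v \<Rightarrow> real"
  where "vnorm \<xi> y v = sqrt (Re (herm \<xi> y v v))"

definition End_norm :: "('x, 'v, 'd::finite) vbundle \<Rightarrow> ('x \<Rightarrow> 'v \<Rightarrow> 'v) \<Rightarrow> real"
  where "End_norm \<xi> h = (SUP y. SUP v\<in>{v \<in> fiber \<xi> y. vnorm \<xi> y v \<le> 1}. vnorm \<xi> y (h y v))"


section \<open>The transfer operator\<close>

text \<open>The value at \<open>y = p x\<close> does not depend on the choice \<open>x = inv_into UNIV p y\<close> of the preimage, because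
  the points \<open>p (psi act rt gs i x)\<close> enumerate the preimages of \<open>y\<close> under \<open>r\<close>.\<close>

definition transfer ::
    "('g \<Rightarrow> 'a \<Rightarrow> 'a) \<Rightarrow> ('a \<Rightarrow> 'x) \<Rightarrow> ('a \<Rightarrow> 'a) \<Rightarrow> ('x \<Rightarrow> 'x) \<Rightarrow> nat \<Rightarrow> (nat \<Rightarrow> 'g)
      \<Rightarrow> ('x, 'v::ab_group_add, 'd::finite) vbundle \<Rightarrow> ('x \<Rightarrow> 'v \<Rightarrow> 'v)
      \<Rightarrow> ('x \<Rightarrow> 'v \<Rightarrow> 'v) \<Rightarrow> ('x \<Rightarrow> 'v \<Rightarrow> 'v)"
  where "transfer act p rt r q gs \<xi> m h = (\<lambda>y. \<lambda>v\<in>fiber \<xi> y.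
    \<Sum>i\<in>{1..q}. let z = p (psi act rt gs i (inv_into UNIV p y)) in
      bundle_map_adjoint \<xi> r m z (h z (m z v)))"

definition power_bounded ::
    "('x, 'v::ab_group_add, 'd::finite) vbundle \<Rightarrow> (('x \<Rightarrow> 'v \<Rightarrow> 'v) \<Rightarrow> ('x \<Rightarrow> 'v \<Rightarrow> 'v)) \<Rightarrow> bool"
  where "power_bounded \<xi> R \<longleftrightarrow>
    (\<exists>C. \<forall>k. \<forall>h\<in>bundle_End \<xi>. End_norm \<xi> ((R ^^ k) h) \<le> C * End_norm \<xi> h)"

definition harmonic ::
    "('x, 'v::ab_group_add, 'd::finite) vbundle \<Rightarrow> (('x \<Rightarrow> 'v \<Rightarrow> 'v) \<Rightarrow> ('x \<Rightarrow> 'v \<Rightarrow> 'v))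
      \<Rightarrow> ('x \<Rightarrow> 'v \<Rightarrow> 'v) \<Rightarrow> bool"
  where "harmonic \<xi> R h \<longleftrightarrow> h \<in> bundle_End \<xi> \<and> R h = h"


section \<open>The Hilbert module \<open>\<Xi>\<close> and the refinement operator\<close>

definition Xi :: "('g, 'b) monoid_scheme \<Rightarrow> ('g \<Rightarrow> 'a::topological_space \<Rightarrow> 'a) \<Rightarrow> ('a \<Rightarrow> complex) set"
  where "Xi G act = {f.
    continuous_on UNIV f \<and> bounded (range f) \<and>
    (\<forall>x. (\<lambda>g. (cmod (f (act g x)))\<^sup>2) summable_on carrier G) \<and>
    continuous_on UNIV (\<lambda>x. \<Sum>\<^sub>\<infinity>g\<in>carrier G. (cmod (f (act g x)))\<^sup>2) \<and>
    bounded (range (\<lambda>x. \<Sum>\<^sub>\<infinity>g\<in>carrier G. (cmod (f (act g x)))\<^sup>2))}"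

text \<open>The sum is \<open>G\<close>-invariant in \<open>x\<close>, hence the choice \<open>x = inv_into UNIV p y\<close> is immaterial.\<close>

definition xi_inner ::
    "('g, 'b) monoid_scheme \<Rightarrow> ('g \<Rightarrow> 'a \<Rightarrow> 'a) \<Rightarrow> ('a \<Rightarrow> 'x)
      \<Rightarrow> ('a \<Rightarrow> complex) \<Rightarrow> ('a \<Rightarrow> complex) \<Rightarrow> 'x \<Rightarrow> complex"
  where "xi_inner G act p f1 f2 y =
    (\<Sum>\<^sub>\<infinity>g\<in>carrier G. cnj (f1 (act g (inv_into UNIV p y))) * f2 (act g (inv_into UNIV p y)))"

definition is_module_adjoint ::
    "('g, 'b) monoid_scheme \<Rightarrow> ('g \<Rightarrow> 'a::topological_space \<Rightarrow> 'a) \<Rightarrow> ('a \<Rightarrow> 'x::topological_space)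
      \<Rightarrow> ('x, 'v, 'd::finite) vbundle
      \<Rightarrow> (('x \<Rightarrow> 'v) \<Rightarrow> ('a \<Rightarrow> complex)) \<Rightarrow> (('a \<Rightarrow> complex) \<Rightarrow> ('x \<Rightarrow> 'v)) \<Rightarrow> bool"
  where "is_module_adjoint G act p \<xi> W V \<longleftrightarrow>
    V \<in> Xi G act \<rightarrow>\<^sub>E sections \<xi> \<and>
    (\<forall>s\<in>sections \<xi>. \<forall>f\<in>Xi G act. xi_inner G act p (W s) f = sec_inner \<xi> s (V f))"

definition module_adjoint ::
    "('g, 'b) monoid_scheme \<Rightarrow> ('g \<Rightarrow> 'a::topological_space \<Rightarrow> 'a) \<Rightarrow> ('a \<Rightarrow> 'x::topological_space)
      \<Rightarrow> ('x, 'v, 'd::finite) vbundle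
      \<Rightarrow> (('x \<Rightarrow> 'v) \<Rightarrow> ('a \<Rightarrow> complex)) \<Rightarrow> (('a \<Rightarrow> complex) \<Rightarrow> ('x \<Rightarrow> 'v))"
  where "module_adjoint G act p \<xi> W = (THE V. is_module_adjoint G act p \<xi> W V)"

definition Hom_S_Xi ::
    "('g, 'b) monoid_scheme \<Rightarrow> ('g \<Rightarrow> 'a::topological_space \<Rightarrow> 'a) \<Rightarrow> ('a \<Rightarrow> 'x::topological_space)
      \<Rightarrow> ('x, 'v::ab_group_add, 'd::finite) vbundle \<Rightarrow> (('x \<Rightarrow> 'v) \<Rightarrow> ('a \<Rightarrow> complex)) set"
  where "Hom_S_Xi G act p \<xi> = {W \<in> sections \<xi> \<rightarrow>\<^sub>E Xi G act.
    (\<forall>s\<in>sections \<xi>. \<forall>t\<in>sections \<xi>. W (\<lambda>y. s y + t y) = (\<lambda>x. W s x + W t x)) \<and>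
    (\<forall>a. continuous_on UNIV a \<longrightarrow>
      (\<forall>s\<in>sections \<xi>. W (\<lambda>y. scl \<xi> (a y) (s y)) = (\<lambda>x. a (p x) * W s x))) \<and>
    (\<exists>V. is_module_adjoint G act p \<xi> W V)}"

definition refine ::
    "('a \<Rightarrow> 'a) \<Rightarrow> ('x \<Rightarrow> 'x) \<Rightarrow> ('x::topological_space, 'v, 'd::finite) vbundle \<Rightarrow> ('x \<Rightarrow> 'v \<Rightarrow> 'v)
      \<Rightarrow> (('x \<Rightarrow> 'v) \<Rightarrow> ('a \<Rightarrow> complex)) \<Rightarrow> (('x \<Rightarrow> 'v) \<Rightarrow> ('a \<Rightarrow> complex))"
  where "refine rt r \<xi> m W = (\<lambda>s\<in>sections \<xi>. W (\<lambda>y. m y (s (r y))) \<circ> inv_into UNIV rt)"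

end

theory Submission
  imports Defs
begin

text \<open>
  Existence of an adjoint forces \<open>(W s) x\<close> to depend linearly on the single vector \<open>s (p x)\<close>;
  conversely every map into \<open>Xi\<close> of this form is adjointable, by the Riesz representation in the
  fibres and the continuity of the inner product of \<open>Xi\<close>. The second description passes from
  \<open>W\<close> to \<open>M W\<close>. It then suffices to compare
  \<open>\<langle>w, h v\<rangle>\<close> for vectors \<open>v, w\<close> in a single fibre, extended to sections \<open>s, t\<close>.
  Since \<open>(inv rt) \<circ> A h = h \<circ> (inv rt)\<close> for \<open>h\<close> in \<open>G\<close>, splitting the sum over \<open>G\<close> along the
  right cosets of \<open>A G\<close> turns \<open>\<langle>M W1 t, M W2 s\<rangle>'\<close> at \<open>p x\<close> into the sum of
  \<open>\<langle>W1 (m t \<circ> r), W2 (m s \<circ> r)\<rangle>'\<close> over the preimages \<open>p (psi i x)\<close> of \<open>p x\<close> under \<open>r\<close>,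
  which is the transfer operator.
\<close>

section \<open>Topological and summability preliminaries\<close>

text \<open>Continuity into the total space of a bundle is only visible chart by chart; this glues
  the local statements. The source is an abstract topology because it can itself be a total
  space.\<close>

lemma continuous_map_locally:
  assumes "\<And>x. x \<in> topspace T \<Longrightarrow> \<exists>U. openin T U \<and> x \<in> U \<and> continuous_map (subtopology T U) Y f"
  shows "continuous_map T Y f"
  unfolding continuous_map_def
proof (intro conjI allI impI)
  show "f \<in> topspace T \<rightarrow> topspace Y"
  proof
    fix x assume x: "x \<in> topspace T"
    then obtain U where "x \<in> U" "continuous_map (subtopology T U) Y f" using assms by blast
    then show "f x \<in> topspace Y" using x by (auto simp: continuous_map_def)
  qed
  fix V assume V: "openin Y V"
  show "openin T {x \<in> topspace T. f x \<in> V}"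
  proof (subst openin_subopen, intro ballI)
    fix x assume x: "x \<in> {x \<in> topspace T. f x \<in> V}"
    then obtain U where U: "openin T U" "x \<in> U" "continuous_map (subtopology T U) Y f"
      using assms by blast
    have "openin (subtopology T U) {z \<in> topspace (subtopology T U). f z \<in> V}"
      using U(3) V by (rule openin_continuous_map_preimage)
    then have "openin T {z \<in> topspace (subtopology T U). f z \<in> V}"
      using U(1) openin_open_subtopology by blast
    then show "\<exists>O'. openin T O' \<and> x \<in> O' \<and> O' \<subseteq> {x \<in> topspace T. f x \<in> V}"
      using x U(2) by (intro exI[of _ "{z \<in> topspace (subtopology T U). f z \<in> V}"]) auto
  qed
qed

text \<open>A tail estimate without any bound uniform in \<open>x\<close>: the tail of the
  dominating series is continuous, being its continuous sum minus a finite partial sum, so a tail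
  that is small at \<open>x0\<close> stays small near \<open>x0\<close>.\<close>

lemma continuous_on_infsum_dominated:
  fixes w :: "'i \<Rightarrow> 'a::topological_space \<Rightarrow> 'c::banach" and D :: "'i \<Rightarrow> 'a \<Rightarrow> real"
  assumes le: "\<And>i x. i \<in> I \<Longrightarrow> norm (w i x) \<le> D i x"
    and cont_w: "\<And>i. i \<in> I \<Longrightarrow> continuous_on UNIV (w i)"
    and cont_D: "\<And>i. i \<in> I \<Longrightarrow> continuous_on UNIV (D i)"
    and summable: "\<And>x. (\<lambda>i. D i x) summable_on I"
    and cont_sum: "continuous_on UNIV (\<lambda>x. \<Sum>\<^sub>\<infinity>i\<in>I. D i x)"
  shows "continuous_on UNIV (\<lambda>x. \<Sum>\<^sub>\<infinity>i\<in>I. w i x)"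
proof -
  have w_summable: "(\<lambda>i. w i x) summable_on J" if "J \<subseteq> I" for x J
  proof (rule abs_summable_summable, rule Infinite_Sum.abs_summable_on_comparison_test')
    show "(\<lambda>i. D i x) summable_on J" using summable that by (rule summable_on_subset_banach)
    show "norm (w i x) \<le> D i x" if "i \<in> J" for i
      using that \<open>J \<subseteq> I\<close> le by auto
  qed
  have split: "infsum f I = sum f F + infsum f (I - F)"
    if "finite F" "F \<subseteq> I" "f summable_on I" "f summable_on (I - F)" for F and f :: "'i \<Rightarrow> 'z::banach"
  proof -
    have "infsum f (F \<union> (I - F)) = infsum f F + infsum f (I - F)"
      using that by (intro infsum_Un_disjoint) auto
    moreover have "F \<union> (I - F) = I" using that by auto
    ultimately show ?thesis using that by simp
  qed
  have "((\<lambda>x. \<Sum>\<^sub>\<infinity>i\<in>I. w i x) \<longlongrightarrow> (\<Sum>\<^sub>\<infinity>i\<in>I. w i x0)) (at x0)" for x0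
  proof (rule tendstoI)
    fix e :: real assume e: "0 < e"
    \<comment> \<open>The approximation is only up to \<le>, so \<open>e/4\<close> is asked for in
      order to have the tail at \<open>x0\<close> strictly below \<open>e/3\<close>.\<close>
    obtain F where F: "finite F" "F \<subseteq> I"
      and Fe: "dist (\<Sum>i\<in>F. D i x0) (\<Sum>\<^sub>\<infinity>i\<in>I. D i x0) \<le> e/4"
      using infsum_finite_approximation[OF summable[of x0], of "e/4"] e by auto
    define tail where "tail x = (\<Sum>\<^sub>\<infinity>i\<in>I. D i x) - (\<Sum>i\<in>F. D i x)" for x
    have D_sub: "(\<lambda>i. D i x) summable_on (I - F)" for x
      using summable by (rule summable_on_subset_banach) auto
    have bound: "dist (\<Sum>\<^sub>\<infinity>i\<in>I. w i x) (\<Sum>i\<in>F. w i x) \<le> tail x" for x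
    proof -
      have "norm (\<Sum>\<^sub>\<infinity>i\<in>I-F. w i x) \<le> (\<Sum>\<^sub>\<infinity>i\<in>I-F. D i x)"
        by (rule norm_infsum_le[OF has_sum_infsum has_sum_infsum]) (use w_summable D_sub le in auto)
      moreover have "(\<Sum>\<^sub>\<infinity>i\<in>I. w i x) = (\<Sum>i\<in>F. w i x) + (\<Sum>\<^sub>\<infinity>i\<in>I-F. w i x)"
        using F w_summable by (intro split) auto
      moreover have "(\<Sum>\<^sub>\<infinity>i\<in>I. D i x) = (\<Sum>i\<in>F. D i x) + (\<Sum>\<^sub>\<infinity>i\<in>I-F. D i x)"
        using F D_sub summable by (intro split) auto
      ultimately show ?thesis by (simp add: tail_def dist_norm)
    qed
    have "continuous_on UNIV tail" unfolding tail_def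
      using F cont_D by (intro continuous_on_diff cont_sum continuous_on_sum) auto
    then have "(tail \<longlongrightarrow> tail x0) (at x0)"
      by (simp add: continuous_on_def)
    moreover have "tail x0 < e/3"
      using Fe e by (simp add: tail_def dist_real_def abs_if split: if_splits)
    ultimately have ev1: "eventually (\<lambda>x. tail x < e/3) (at x0)"
      by (rule order_tendstoD)
    have "continuous_on UNIV (\<lambda>x. \<Sum>i\<in>F. w i x)"
      using F cont_w by (intro continuous_on_sum) auto
    then have "((\<lambda>x. \<Sum>i\<in>F. w i x) \<longlongrightarrow> (\<Sum>i\<in>F. w i x0)) (at x0)"
      by (simp add: continuous_on_def)
    then have ev2: "eventually (\<lambda>x. dist (\<Sum>i\<in>F. w i x) (\<Sum>i\<in>F. w i x0) < e/3) (at x0)"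
      using e by (intro tendstoD) auto
    show "eventually (\<lambda>x. dist (\<Sum>\<^sub>\<infinity>i\<in>I. w i x) (\<Sum>\<^sub>\<infinity>i\<in>I. w i x0) < e) (at x0)"
      using ev1 ev2
    proof eventually_elim
      case (elim x)
      then show ?case
        using bound[of x] bound[of x0] \<open>tail x0 < e/3\<close>
          dist_triangle[of "\<Sum>\<^sub>\<infinity>i\<in>I. w i x" "\<Sum>\<^sub>\<infinity>i\<in>I. w i x0" "\<Sum>i\<in>F. w i x"]
          dist_triangle[of "\<Sum>i\<in>F. w i x" "\<Sum>\<^sub>\<infinity>i\<in>I. w i x0" "\<Sum>i\<in>F. w i x0"]
        by (simp add: dist_commute)
    qed
  qed
  then show ?thesis by (simp add: continuous_on_def)
qed

lemma norm_cnj_mult_le: "norm (cnj a * b) \<le> (cmod a)\<^sup>2 + (cmod b)\<^sup>2"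
proof -
  have "2 * (cmod a * cmod b) \<le> (cmod a)\<^sup>2 + (cmod b)\<^sup>2"
    using sum_squares_bound[of "cmod a" "cmod b"] by simp
  then have "cmod a * cmod b \<le> (cmod a)\<^sup>2 + (cmod b)\<^sup>2"
    using mult_nonneg_nonneg[OF norm_ge_zero[of a] norm_ge_zero[of b]] by linarith
  then show ?thesis by (simp add: norm_mult)
qed

section \<open>Linear maps between subspaces\<close>

lemma linear_between_0:
  assumes "linear_between s1 V s2 W T" and "0 \<in> V"
  shows "T 0 = 0"
  using assms unfolding linear_between_def by (metis add_cancel_right_right)

lemma linear_between_in: "linear_between s1 V s2 W T \<Longrightarrow> v \<in> V \<Longrightarrow> T v \<in> W"
  by (auto simp: linear_between_def)

lemma linear_between_add:
  "linear_between s1 V s2 W T \<Longrightarrow> u \<in> V \<Longrightarrow> v \<in> V \<Longrightarrow> T (u + v) = T u + T v"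
  by (auto simp: linear_between_def)

lemma linear_between_scale:
  "linear_between s1 V s2 W T \<Longrightarrow> v \<in> V \<Longrightarrow> T (s1 c v) = s2 c (T v)"
  by (auto simp: linear_between_def)

lemma linear_between_sum:
  assumes T: "linear_between s1 V s2 W T" and "vector_space s1" and V: "module.subspace s1 V"
    and "finite I" and v: "\<And>i. i \<in> I \<Longrightarrow> v i \<in> V"
  shows "T (\<Sum>i\<in>I. s1 (c i) (v i)) = (\<Sum>i\<in>I. s2 (c i) (T (v i)))"
proof -
  interpret vector_space s1 by fact
  show ?thesis
    using \<open>finite I\<close> v
  proof (induction rule: finite_induct)
    case empty
    then show ?case using linear_between_0[OF T] V by (simp add: subspace_0)
  next
    case (insert i I)
    have "s1 (c i) (v i) \<in> V" "(\<Sum>i\<in>I. s1 (c i) (v i)) \<in> V"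
      using insert V by (auto intro!: subspace_scale subspace_sum)
    then show ?case
      using insert T by (simp add: linear_between_add linear_between_scale)
  qed
qed

lemma (in group) bij_betw_right_translation:
  "k \<in> carrier G \<Longrightarrow> bij_betw (\<lambda>g. g \<otimes>\<^bsub>G\<^esub> k) (carrier G) (carrier G)"
  by (rule bij_betw_byWitness[where f' = "\<lambda>g. g \<otimes>\<^bsub>G\<^esub> inv\<^bsub>G\<^esub> k"]) (auto simp: m_assoc)

section \<open>The orbit map and the coset decomposition\<close>

context self_covering
begin

abbreviation "rti \<equiv> inv_into UNIV rt"

sublocale group G
  using action group_action.group_hom group_hom.axioms(1) by blast

lemma act_mult: "g \<in> carrier G \<Longrightarrow> h \<in> carrier G \<Longrightarrow> act (g \<otimes>\<^bsub>G\<^esub> h) x = act g (act h x)"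
  using group_action.composition_rule[OF action] by simp

lemma act_one [simp]: "act \<one>\<^bsub>G\<^esub> x = x"
  using group_action.id_eq_one[OF action] by (metis UNIV_I restrict_apply)

lemma p_act [simp]: "g \<in> carrier G \<Longrightarrow> p (act g x) = p x"
  using p_orbit by metis

lemma continuous_on_act: "g \<in> carrier G \<Longrightarrow> continuous_on S (act g)"
  by (rule continuous_onI) (auto simp: isometric)

lemma dist_p_le: "dist (p x) (p y) \<le> dist x y"
proof -
  have "(INF g\<in>carrier G. dist x (act g y)) \<le> dist x (act \<one>\<^bsub>G\<^esub> y)"
    by (rule cINF_lower) (auto intro!: bdd_belowI2[where m=0])
  then show ?thesis by (simp add: p_dist)
qed

lemma continuous_on_p: "continuous_on S p"
  by (rule continuous_onI) (meson dist_p_le order_trans less_imp_le)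

text \<open>The quotient metric makes \<open>p\<close> open: by the infimum over \<open>G\<close>, a
  point at distance less than \<open>e\<close> from \<open>p x\<close> has a preimage at distance
  less than \<open>e\<close> from \<open>x\<close>.\<close>

lemma quotient_map_p: "quotient_map euclidean euclidean p"
proof (rule continuous_open_imp_quotient_map)
  show "continuous_map euclidean euclidean p" by (simp add: continuous_on_p)
  show "p ` topspace euclidean = topspace euclidean" using p_surj by simp
  show "open_map euclidean euclidean p"
    unfolding open_map_def
  proof (intro allI impI)
    fix U :: "'a set" assume "openin euclidean U"
    then have "open U" by simp
    have "open (p ` U)"
      unfolding open_dist
    proof
      fix y assume "y \<in> p ` U"
      then obtain x where x: "x \<in> U" "y = p x" by auto
      then obtain e where e: "e > 0" "\<And>z. dist z x < e \<Longrightarrow> z \<in> U"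
        using \<open>open U\<close> open_dist by metis
      have "y' \<in> p ` U" if y': "dist y' y < e" for y'
      proof -
        obtain x' where x': "y' = p x'" using p_surj by auto
        have "(INF g\<in>carrier G. dist x (act g x')) < e"
          using y' by (metis dist_commute p_dist x'(1) x(2))
        then obtain g where g: "g \<in> carrier G" "dist x (act g x') < e"
          by (subst (asm) cINF_less_iff) (auto intro!: bdd_belowI2[where m=0])
        then have "act g x' \<in> U" using e by (metis dist_commute)
        then show ?thesis using g x' by (metis image_eqI p_act)
      qed
      then show "\<exists>e>0. \<forall>y'. dist y' y < e \<longrightarrow> y' \<in> p ` U" using e by blast
    qed
    then show "openin euclidean (p ` U)" by simp
  qed
qed

text \<open>Lets continuity on the quotient be checked on the covering space, where the orbit sums
  and the trivialization live.\<close>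

lemma continuous_map_descend:
  "continuous_map euclidean T (\<lambda>x. f (p x)) \<Longrightarrow> continuous_map euclidean T f"
  using continuous_compose_quotient_map[OF quotient_map_p, of T f] by (simp add: o_def)

lemma continuous_on_rti: "continuous_on UNIV rti" and continuous_on_rt: "continuous_on UNIV rt"
  and rti_rt [simp]: "rti (rt x) = x" and rt_rti [simp]: "rt (rti x) = x"
  using rt_homeomorphism by (auto simp: homeomorphism_def)

lemma continuous_on_r: "continuous_on UNIV r"
proof -
  have "continuous_on UNIV (\<lambda>x. p (rt x))"
    by (rule continuous_on_compose2[OF continuous_on_p continuous_on_rt]) auto
  then show ?thesis
    using continuous_map_descend[of euclidean r] by (simp add: r_p)
qed

lemma A_closed: "g \<in> carrier G \<Longrightarrow> A g \<in> carrier G"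
  using A_hom by (rule hom_in_carrier)

lemma rti_act_A: "h \<in> carrier G \<Longrightarrow> rti (act (A h) x) = act h (rti x)"
  using rt_equivariant[of h "rti x"] by (metis rt_rti rti_rt)

text \<open>By equivariance, \<open>A g = A h\<close> gives
  \<open>rt (act g x) = rt (act h x)\<close>. As \<open>rt\<close> is injective, \<open>g\<close>
  and \<open>h\<close> act alike, and freeness identifies them.\<close>

lemma inj_on_A: "inj_on A (carrier G)"
proof (rule inj_onI)
  fix g h assume gh: "g \<in> carrier G" "h \<in> carrier G" "A g = A h"
  have "act g x = act h x" for x
    using rt_equivariant[of g x] rt_equivariant[of h x] gh by (metis rti_rt)
  then have "act (inv\<^bsub>G\<^esub> h \<otimes>\<^bsub>G\<^esub> g) x = x" for x
    using gh by (metis act_mult act_one inv_closed l_inv)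
  then have "inv\<^bsub>G\<^esub> h \<otimes>\<^bsub>G\<^esub> g = \<one>\<^bsub>G\<^esub>"
    using gh by (intro free) auto
  then show "g = h" using gh by (metis inv_closed inv_inv inv_unique' l_inv inv_equality)
qed

abbreviation "ps \<equiv> psi act rt gs"

lemma r_p_psi: "i \<in> {1..q} \<Longrightarrow> r (p (ps i x)) = p x"
  by (simp add: psi_def r_p gs_carrier)

text \<open>\<open>G\<close> is the disjoint union of the \<open>q\<close> right cosets of
  \<open>A G\<close>. Since \<open>A\<close> is injective,
  \<open>h \<mapsto> A h \<otimes> gs i\<close> parametrizes the \<open>i\<close>-th coset by
  \<open>G\<close>, and there \<open>rti\<close> turns the action of this product on
  \<open>x\<close> into \<open>act h (ps i x)\<close>. The form with \<open>has_sum\<close> yields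
  summability and value at once and serves both for squares and for products.\<close>

lemma has_sum_cosets:
  fixes F :: "'a \<Rightarrow> 'c::topological_comm_monoid_add"
  assumes "\<And>i. i \<in> {1..q} \<Longrightarrow> ((\<lambda>h. F (act h (ps i x))) has_sum S i) (carrier G)"
  shows "((\<lambda>g. F (rti (act g x))) has_sum (\<Sum>i=1..q. S i)) (carrier G)"
proof -
  let ?H = "A ` carrier G" and ?B = "\<lambda>i. (\<lambda>h. A h \<otimes>\<^bsub>G\<^esub> gs i) ` carrier G"
  have sub: "subgroup ?H G" using A_normal normal_imp_subgroup by blast
  have B: "?B i = ?H #>\<^bsub>G\<^esub> gs i" for i by (auto simp: r_coset_def)
  have img: "(\<lambda>i. ?H #>\<^bsub>G\<^esub> gs i) ` {1..q} = rcosets\<^bsub>G\<^esub> ?H"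
    using gs_representatives by (simp add: bij_betw_def)
  have "((\<lambda>g. F (rti (act g x))) has_sum (\<Sum>i=1..q. S i)) (\<Union>i\<in>{1..q}. ?B i)"
  proof (rule sum_has_sum)
    show "?B i \<inter> ?B j = {}" if "i \<in> {1..q}" "j \<in> {1..q}" "i \<noteq> j" for i j
    proof -
      have "?B i \<noteq> ?B j" using gs_representatives that unfolding B bij_betw_def inj_on_def by blast
      moreover have "?B i \<in> rcosets\<^bsub>G\<^esub> ?H" "?B j \<in> rcosets\<^bsub>G\<^esub> ?H"
        using img that unfolding B by blast+
      ultimately show ?thesis
        using rcos_disjoint[OF sub] by (simp add: pairwise_def disjnt_def)
    qed
    fix i assume i: "i \<in> {1..q}"
    have "inj_on (\<lambda>h. A h \<otimes>\<^bsub>G\<^esub> gs i) (carrier G)"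
      using i inj_on_A by (auto simp: inj_on_def gs_carrier A_closed)
    moreover have "F (rti (act (A h \<otimes>\<^bsub>G\<^esub> gs i) x)) = F (act h (ps i x))" if "h \<in> carrier G" for h
      using that i by (simp add: act_mult A_closed gs_carrier rti_act_A psi_def)
    ultimately show "((\<lambda>g. F (rti (act g x))) has_sum S i) (?B i)"
      using assms[OF i] by (subst has_sum_reindex) (auto simp: o_def cong: has_sum_cong)
  qed simp
  moreover have "(\<Union>i\<in>{1..q}. ?B i) = carrier G"
    unfolding B using rcosets_part_G[OF sub] img by metis
  ultimately show ?thesis by metis
qed

section \<open>The Hilbert module of square summable functions\<close>

text \<open>The inner product of \<open>Xi\<close> lifted to the covering space, at an arbitrary
  point instead of the preimage chosen in \<open>xi_inner\<close>.\<close>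

definition orbit_sum :: "('a \<Rightarrow> complex) \<Rightarrow> ('a \<Rightarrow> complex) \<Rightarrow> 'a \<Rightarrow> complex"
  where "orbit_sum f1 f2 x = (\<Sum>\<^sub>\<infinity>g\<in>carrier G. cnj (f1 (act g x)) * f2 (act g x))"

text \<open>The chosen preimage of \<open>p x\<close> is \<open>act k x\<close> for some
  \<open>k\<close> in \<open>G\<close>, and right translation by \<open>k\<close> only permutes the
  summands.\<close>

lemma xi_inner_p: "xi_inner G act p f1 f2 (p x) = orbit_sum f1 f2 x"
proof -
  have "p (inv_into UNIV p (p x)) = p x" using p_surj by (simp add: surj_f_inv_f)
  then obtain k where k: "k \<in> carrier G" "inv_into UNIV p (p x) = act k x"
    using p_orbit by metis
  let ?F = "\<lambda>g. cnj (f1 (act g x)) * f2 (act g x)"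
  have "xi_inner G act p f1 f2 (p x) = (\<Sum>\<^sub>\<infinity>g\<in>carrier G. ?F (g \<otimes>\<^bsub>G\<^esub> k))"
    unfolding xi_inner_def k(2) using k(1) by (intro infsum_cong) (simp add: act_mult)
  also have "\<dots> = infsum ?F (carrier G)"
    by (rule infsum_reindex_bij_betw[OF bij_betw_right_translation[OF k(1)]])
  finally show ?thesis by (simp add: orbit_sum_def)
qed

lemma Xi_square_summable: "f \<in> Xi G act \<Longrightarrow> (\<lambda>g. (cmod (f (act g x)))\<^sup>2) summable_on carrier G"
  by (simp add: Xi_def)

lemma Xi_product_summable:
  assumes "f1 \<in> Xi G act" "f2 \<in> Xi G act"
  shows "(\<lambda>g. cnj (f1 (act g x)) * f2 (act g x)) summable_on carrier G"
  by (rule abs_summable_summable,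
      rule Infinite_Sum.abs_summable_on_comparison_test'[OF summable_on_add[OF Xi_square_summable[OF assms(1)] Xi_square_summable[OF assms(2)]]])
     (rule norm_cnj_mult_le)

text \<open>The terms are dominated by the sum of the two squares, whose orbit sum is continuous by
  the definition of \<open>Xi\<close>.\<close>

lemma continuous_on_orbit_sum:
  assumes "f1 \<in> Xi G act" "f2 \<in> Xi G act"
  shows "continuous_on UNIV (orbit_sum f1 f2)"
proof -
  have c: "continuous_on UNIV (\<lambda>x. f (act g x))" if "f \<in> Xi G act" "g \<in> carrier G" for f g
    by (rule continuous_on_compose2[OF _ continuous_on_act[OF that(2)]]) (use that in \<open>auto simp: Xi_def\<close>)
  have "continuous_on UNIV (\<lambda>x. \<Sum>\<^sub>\<infinity>g\<in>carrier G. cnj (f1 (act g x)) * f2 (act g x))"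
  proof (rule continuous_on_infsum_dominated[where D = "\<lambda>g x. (cmod (f1 (act g x)))\<^sup>2 + (cmod (f2 (act g x)))\<^sup>2"])
    show "continuous_on UNIV (\<lambda>x. \<Sum>\<^sub>\<infinity>g\<in>carrier G. (cmod (f1 (act g x)))\<^sup>2 + (cmod (f2 (act g x)))\<^sup>2)"
      using assms by (subst infsum_add) (auto simp: Xi_def intro!: continuous_on_add)
  qed (use assms c in \<open>auto intro!: norm_cnj_mult_le continuous_intros summable_on_add Xi_square_summable\<close>)
  then show ?thesis by (simp add: orbit_sum_def[abs_def])
qed

lemma continuous_on_xi_inner:
  "f1 \<in> Xi G act \<Longrightarrow> f2 \<in> Xi G act \<Longrightarrow> continuous_on UNIV (xi_inner G act p f1 f2)"
  using continuous_map_descend[of euclidean "xi_inner G act p f1 f2"]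
    continuous_on_orbit_sum[of f1 f2]
  by (simp add: xi_inner_p)

text \<open>Pointwise definiteness: the orbit sum is a sum of squares, and the term at the unit of
  \<open>G\<close> is the one for \<open>x\<close> itself.\<close>

lemma orbit_sum_self_eq_0D:
  assumes f: "f \<in> Xi G act" and "orbit_sum f f x = 0"
  shows "f x = 0"
proof -
  have "orbit_sum f f x = (\<Sum>\<^sub>\<infinity>g\<in>carrier G. complex_of_real ((cmod (f (act g x)))\<^sup>2))"
    unfolding orbit_sum_def by (intro infsum_cong) (simp only: complex_norm_square mult.commute)
  also have "\<dots> = of_real (\<Sum>\<^sub>\<infinity>g\<in>carrier G. (cmod (f (act g x)))\<^sup>2)"
    by (intro infsumI has_sum_of_real has_sum_infsum Xi_square_summable f)
  finally have "(\<Sum>\<^sub>\<infinity>g\<in>carrier G. (cmod (f (act g x)))\<^sup>2) = 0"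
    using assms(2) by simp
  then have "(cmod (f (act \<one>\<^bsub>G\<^esub> x)))\<^sup>2 = 0"
    using Xi_square_summable[OF f] by (intro nonneg_infsum_le_0D[where A = "carrier G"]) auto
  then show ?thesis by simp
qed

text \<open>By the coset decomposition, the orbit sum of the squares for
  \<open>f \<circ> rti\<close> at \<open>x\<close> is the finite sum of those for \<open>f\<close>
  at the points \<open>ps i x\<close>, so continuity and boundedness carry over.\<close>

lemma Xi_compose_rti:
  assumes f: "f \<in> Xi G act"
  shows "f \<circ> rti \<in> Xi G act"
proof -
  let ?n = "\<lambda>x. \<Sum>\<^sub>\<infinity>g\<in>carrier G. (cmod (f (act g x)))\<^sup>2"
  have psi_cont: "continuous_on UNIV (ps i)" if "i \<in> {1..q}" for i
    unfolding psi_def using continuous_on_compose2[OF continuous_on_rti continuous_on_act[OF gs_carrier[OF that]]] by auto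
  have hs: "((\<lambda>g. (cmod ((f \<circ> rti) (act g x)))\<^sup>2) has_sum (\<Sum>i=1..q. ?n (ps i x))) (carrier G)" for x
    using has_sum_cosets[of "\<lambda>z. (cmod (f z))\<^sup>2" x "\<lambda>i. ?n (ps i x)"]
      has_sum_infsum[OF Xi_square_summable[OF f]] by simp
  have n: "(\<lambda>x. \<Sum>\<^sub>\<infinity>g\<in>carrier G. (cmod ((f \<circ> rti) (act g x)))\<^sup>2) = (\<lambda>x. \<Sum>i=1..q. ?n (ps i x))"
    using hs infsumI by blast
  have "continuous_on UNIV (\<lambda>x. \<Sum>i=1..q. ?n (ps i x))"
    using f by (intro continuous_on_sum continuous_on_compose2[OF _ psi_cont, of UNIV ?n]) (auto simp: Xi_def)
  moreover obtain C where C: "\<And>x. norm (?n x) \<le> C"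
    using f unfolding Xi_def bounded_iff by auto
  have "bounded (range (\<lambda>x. \<Sum>i=1..q. ?n (ps i x)))"
    unfolding bounded_iff
    by (rule exI[of _ "\<Sum>i=1..q. C"]) (use C in \<open>blast intro: order_trans[OF norm_sum] sum_mono\<close>)
  moreover have "continuous_on UNIV (f \<circ> rti)"
    using f continuous_on_rti by (intro continuous_on_compose) (auto simp: Xi_def intro: continuous_on_subset)
  moreover have "bounded (range (f \<circ> rti))"
    using f by (auto simp: Xi_def intro: bounded_subset)
  ultimately show ?thesis
    using hs unfolding Xi_def mem_Collect_eq n by (auto intro: has_sum_imp_summable)
qed

text \<open>The source of the sum over preimages in the transfer operator: the coset decomposition
  applied to the products of values.\<close>

lemma xi_inner_compose_rti:
  assumes "f1 \<in> Xi G act" "f2 \<in> Xi G act"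
  shows "xi_inner G act p (f1 \<circ> rti) (f2 \<circ> rti) (p x) = (\<Sum>i=1..q. xi_inner G act p f1 f2 (p (ps i x)))"
  unfolding xi_inner_p
  using has_sum_cosets[of "\<lambda>z. cnj (f1 z) * f2 z" x "\<lambda>i. orbit_sum f1 f2 (ps i x)"]
    has_sum_infsum[OF Xi_product_summable[OF assms]]
  by (auto simp: orbit_sum_def intro!: infsumI)

lemma xi_inner_cnj: "xi_inner G act p f2 f1 y = cnj (xi_inner G act p f1 f2 y)"
  unfolding xi_inner_def by (simp flip: infsum_cnj add: mult.commute)

end

section \<open>Sections of the bundle\<close>

text \<open>The source is an arbitrary topology because coordinates on the total space of the bundle
  have to be scaled as well.\<close>

lemma continuous_map_vector_scalar_mult:
  fixes a :: "'t \<Rightarrow> complex" and v :: "'t \<Rightarrow> complex ^ 'd"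
  assumes "continuous_map T euclidean a" "continuous_map T euclidean v"
  shows "continuous_map T euclidean (\<lambda>e. a e *s v e)"
  unfolding continuous_map_atin limitin_canonical_iff
proof (intro ballI vec_tendstoI)
  fix x j assume "x \<in> topspace T"
  then have "(a \<longlongrightarrow> a x) (atin T x)" "(v \<longlongrightarrow> v x) (atin T x)"
    using assms by (auto simp: continuous_map_atin)
  from tendsto_mult[OF this(1) tendsto_vec_nth[OF this(2)]]
  show "((\<lambda>e. (a e *s v e) $ j) \<longlongrightarrow> (a x *s v x) $ j) (atin T x)" by simp
qed

lemma lipschitz_vector_bundleD:
  assumes "lipschitz_vector_bundle \<xi>"
  shows "vector_space (scl \<xi>)"
    and "\<forall>y. module.subspace (scl \<xi>) (fiber \<xi> y)"
    and "continuous_map (total \<xi>) euclidean fst"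
    and "\<Union> (fst ` charts \<xi>) = UNIV"
    and "\<forall>(U, \<phi>) \<in> charts \<xi>. open U \<and>
      (\<forall>y\<in>U. linear_between (scl \<xi>) (fiber \<xi> y) (*s) UNIV (\<phi> y) \<and>
              bij_betw (\<phi> y) (fiber \<xi> y) UNIV) \<and>
      homeomorphic_map (subtopology (total \<xi>) (U \<times> UNIV)) (top_of_set (U \<times> UNIV))
        (\<lambda>(y, v). (y, \<phi> y v))"
  using assms unfolding lipschitz_vector_bundle_def by - (elim conjE, assumption)+

text \<open>One isometric trivialization \<open>\<tau>\<close> of the pullback is fixed, so that it
  can serve as a unitary coordinate system in the fibre over \<open>p x\<close>, depending
  continuously on \<open>x\<close>.\<close>

locale trivialized_bundle = self_covering G act p A rt r q gs
  for G :: "('g, 'b) monoid_scheme"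
    and act :: "'g \<Rightarrow> 'a::metric_space \<Rightarrow> 'a"
    and p :: "'a \<Rightarrow> 'x::metric_space"
    and A rt r q gs +
  fixes \<xi> :: "('x, 'v::ab_group_add, 'd::finite) vbundle"
    and \<tau> :: "'a \<Rightarrow> 'v \<Rightarrow> complex ^ 'd"
  assumes lipschitz_bundle: "lipschitz_vector_bundle \<xi>"
    and tau_linear: "\<And>x. linear_between (scl \<xi>) (fiber \<xi> (p x)) (*s) UNIV (\<tau> x)"
    and tau_bij: "\<And>x. bij_betw (\<tau> x) (fiber \<xi> (p x)) UNIV"
    and hermitian: "hermitian_metric \<xi>"
    and herm_tau: "\<And>x u v. u \<in> fiber \<xi> (p x) \<Longrightarrow> v \<in> fiber \<xi> (p x) \<Longrightarrow>
      herm \<xi> (p x) u v = (\<Sum>j\<in>UNIV. cnj (\<tau> x u $ j) * \<tau> x v $ j)"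
    and tau_homeomorphic: "homeomorphic_map (pullback \<xi> p) euclidean (\<lambda>(x, _, v). (x, \<tau> x v))"
begin

sublocale V: vector_space "scl \<xi>"
  by (rule lipschitz_vector_bundleD(1)[OF lipschitz_bundle])

lemma fiber_subspace: "V.subspace (fiber \<xi> y)"
  using lipschitz_vector_bundleD(2)[OF lipschitz_bundle] by blast

lemmas fiber_closed [simp] = V.subspace_0[OF fiber_subspace] V.subspace_add[OF fiber_subspace]
  V.subspace_scale[OF fiber_subspace]

lemma fiber_combination: "(\<And>i. i \<in> I \<Longrightarrow> v i \<in> fiber \<xi> y) \<Longrightarrow> (\<Sum>i\<in>I. scl \<xi> (c i) (v i)) \<in> fiber \<xi> y"
  by (intro V.subspace_sum[OF fiber_subspace]) simp

lemma in_topspace_total: "(y, v) \<in> topspace (total \<xi>) \<longleftrightarrow> v \<in> fiber \<xi> y"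
  by (simp add: fiber_def)

lemma continuous_map_total_fst: "continuous_map (total \<xi>) euclidean fst"
  by (rule lipschitz_vector_bundleD(3)[OF lipschitz_bundle])

lemma chart_exists: obtains U \<phi> where "(U, \<phi>) \<in> charts \<xi>" "y \<in> U"
proof -
  have "y \<in> \<Union> (fst ` charts \<xi>)"
    using lipschitz_vector_bundleD(4)[OF lipschitz_bundle] by simp
  then show ?thesis using that by force
qed

context
  fixes U \<phi> assumes chart: "(U, \<phi>) \<in> charts \<xi>"
begin

lemma chart_open: "open U"
  and chart_linear: "y \<in> U \<Longrightarrow> linear_between (scl \<xi>) (fiber \<xi> y) (*s) UNIV (\<phi> y)"
  and chart_bij: "y \<in> U \<Longrightarrow> bij_betw (\<phi> y) (fiber \<xi> y) UNIV"
  and chart_homeomorphic: "homeomorphic_map (subtopology (total \<xi>) (U \<times> UNIV))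
    (top_of_set (U \<times> UNIV)) (\<lambda>(y, v). (y, \<phi> y v))"
  using lipschitz_vector_bundleD(5)[OF lipschitz_bundle] chart by auto

lemma continuous_map_chart:
  "continuous_map (subtopology (total \<xi>) (U \<times> UNIV)) euclidean (\<lambda>(y, v). \<phi> y v)"
proof -
  have "continuous_map (subtopology (total \<xi>) (U \<times> UNIV)) euclidean (\<lambda>(y, v). (y, \<phi> y v))"
    using homeomorphic_imp_continuous_map[OF chart_homeomorphic] continuous_map_into_fulltopology by blast
  then have "continuous_map (subtopology (total \<xi>) (U \<times> UNIV)) euclidean (snd \<circ> (\<lambda>(y, v). (y, \<phi> y v)))"
    by (rule continuous_map_compose) (simp add: continuous_on_snd)
  then show ?thesis by (simp add: o_def case_prod_unfold)
qed

text \<open>The map is recovered from its chart coordinates by composing them with the continuous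
  inverse \<open>k\<close> of the chart.\<close>

lemma continuous_map_total_chartI:
  assumes f: "continuous_map T euclidean f" and fU: "\<And>e. e \<in> topspace T \<Longrightarrow> f e \<in> U"
    and u: "\<And>e. e \<in> topspace T \<Longrightarrow> u e \<in> fiber \<xi> (f e)"
    and c: "continuous_map T euclidean (\<lambda>e. \<phi> (f e) (u e))"
  shows "continuous_map T (total \<xi>) (\<lambda>e. (f e, u e))"
proof -
  obtain k where k: "homeomorphic_maps (subtopology (total \<xi>) (U \<times> UNIV))
      (top_of_set (U \<times> UNIV)) (\<lambda>(y, v). (y, \<phi> y v)) k"
    using chart_homeomorphic homeomorphic_map_maps by blast
  have "continuous_map T (prod_topology euclidean euclidean) (\<lambda>e. (f e, \<phi> (f e) (u e)))"
    using f c by (rule continuous_map_pairedI)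
  then have "continuous_map T (top_of_set (U \<times> UNIV)) (\<lambda>e. (f e, \<phi> (f e) (u e)))"
    by (intro continuous_map_into_subtopology) (auto simp: fU)
  then have "continuous_map T (subtopology (total \<xi>) (U \<times> UNIV)) (k \<circ> (\<lambda>e. (f e, \<phi> (f e) (u e))))"
    by (rule continuous_map_compose) (use k in \<open>auto simp: homeomorphic_maps_def\<close>)
  then have "continuous_map T (total \<xi>) (k \<circ> (\<lambda>e. (f e, \<phi> (f e) (u e))))"
    by (rule continuous_map_into_fulltopology)
  moreover have "(k \<circ> (\<lambda>e. (f e, \<phi> (f e) (u e)))) e = (f e, u e)" if "e \<in> topspace T" for e
  proof -
    have "(f e, u e) \<in> topspace (subtopology (total \<xi>) (U \<times> UNIV))"
      using that u fU by (simp add: in_topspace_total)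
    then show ?thesis using k unfolding homeomorphic_maps_def by fastforce
  qed
  ultimately show ?thesis by (rule continuous_map_eq)
qed

end

lemma continuous_map_totalI:
  assumes f: "continuous_map T euclidean f"
    and u: "\<And>e. e \<in> topspace T \<Longrightarrow> u e \<in> fiber \<xi> (f e)"
    and charts: "\<And>e. e \<in> topspace T \<Longrightarrow> \<exists>U \<phi> N. (U, \<phi>) \<in> charts \<xi> \<and> openin T N \<and> e \<in> N \<and> f ` N \<subseteq> U \<and>
      continuous_map (subtopology T N) euclidean (\<lambda>e. \<phi> (f e) (u e))"
  shows "continuous_map T (total \<xi>) (\<lambda>e. (f e, u e))"
proof (rule continuous_map_locally)
  fix e assume "e \<in> topspace T"
  then obtain U \<phi> N where N: "(U, \<phi>) \<in> charts \<xi>" "openin T N" "e \<in> N" "f ` N \<subseteq> U"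
      "continuous_map (subtopology T N) euclidean (\<lambda>e. \<phi> (f e) (u e))"
    using charts by blast
  have "continuous_map (subtopology T N) (total \<xi>) (\<lambda>e. (f e, u e))"
    using N f u by (intro continuous_map_total_chartI[OF N(1)] continuous_map_from_subtopology[OF f]) auto
  then show "\<exists>N. openin T N \<and> e \<in> N \<and> continuous_map (subtopology T N) (total \<xi>) (\<lambda>e. (f e, u e))"
    using N by blast
qed

section \<open>Continuous sections and local frames\<close>

lemma section_in_fiber: "s \<in> sections \<xi> \<Longrightarrow> s y \<in> fiber \<xi> y"
  unfolding sections_def continuous_map_def by (auto simp: in_topspace_total)

lemma continuous_on_section_chart:
  assumes s: "s \<in> sections \<xi>" and chart: "(U, \<phi>) \<in> charts \<xi>"
  shows "continuous_on U (\<lambda>y. \<phi> y (s y))"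
proof -
  have "continuous_map (top_of_set U) (total \<xi>) (\<lambda>y. (y, s y))"
    using s by (auto simp: sections_def intro: continuous_map_from_subtopology)
  then have "continuous_map (top_of_set U) (subtopology (total \<xi>) (U \<times> UNIV)) (\<lambda>y. (y, s y))"
    by (intro continuous_map_into_subtopology) auto
  from continuous_map_compose[OF this continuous_map_chart[OF chart]]
  show ?thesis by (simp add: o_def)
qed

text \<open>In a chart the combination becomes a sum of products of continuous functions. The map
  \<open>f\<close> is kept general: the identity of the base gives new sections, the bundle
  projection gives continuity of bundle endomorphisms.\<close>

lemma continuous_map_combination:
  assumes f: "continuous_map T euclidean f" and I: "finite I"
    and a: "\<And>i. i \<in> I \<Longrightarrow> continuous_map T euclidean (a i)"
    and s: "\<And>i. i \<in> I \<Longrightarrow> s i \<in> sections \<xi>"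
  shows "continuous_map T (total \<xi>) (\<lambda>e. (f e, \<Sum>i\<in>I. scl \<xi> (a i e) (s i (f e))))"
proof (rule continuous_map_totalI[OF f])
  show "(\<Sum>i\<in>I. scl \<xi> (a i e) (s i (f e))) \<in> fiber \<xi> (f e)" for e
    using s by (intro fiber_combination section_in_fiber)
  fix e assume e: "e \<in> topspace T"
  obtain U \<phi> where chart: "(U, \<phi>) \<in> charts \<xi>" and fe: "f e \<in> U" by (rule chart_exists)
  define N where "N = {e \<in> topspace T. f e \<in> U}"
  have N: "openin T N"
    unfolding N_def using f chart_open[OF chart] by (intro openin_continuous_map_preimage) auto
  have fN: "continuous_map (subtopology T N) (top_of_set U) f"
    using f by (intro continuous_map_into_subtopology continuous_map_from_subtopology) (auto simp: N_def)
  have "continuous_map (subtopology T N) euclidean ((\<lambda>y. \<phi> y (s i y)) \<circ> f)" if "i \<in> I" for i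
    using fN by (rule continuous_map_compose) (simp add: continuous_on_section_chart[OF s chart] that)
  then have "continuous_map (subtopology T N) euclidean (\<lambda>e. \<Sum>i\<in>I. a i e *s \<phi> (f e) (s i (f e)))"
    using I a by (intro continuous_map_sum continuous_map_vector_scalar_mult)
      (auto simp: o_def intro: continuous_map_from_subtopology)
  moreover have "(\<Sum>i\<in>I. a i e *s \<phi> (f e) (s i (f e))) = \<phi> (f e) (\<Sum>i\<in>I. scl \<xi> (a i e) (s i (f e)))"
    if "e \<in> topspace (subtopology T N)" for e
    using that I s by (subst linear_between_sum[OF chart_linear[OF chart] V.vector_space_axioms fiber_subspace])
      (auto simp: N_def section_in_fiber)
  ultimately have "continuous_map (subtopology T N) euclidean (\<lambda>e. \<phi> (f e) (\<Sum>i\<in>I. scl \<xi> (a i e) (s i (f e))))"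
    by (rule continuous_map_eq)
  then show "\<exists>U \<phi> N. (U, \<phi>) \<in> charts \<xi> \<and> openin T N \<and> e \<in> N \<and> f ` N \<subseteq> U \<and>
      continuous_map (subtopology T N) euclidean (\<lambda>e. \<phi> (f e) (\<Sum>i\<in>I. scl \<xi> (a i e) (s i (f e))))"
    using chart N e fe by (intro exI[of _ U] exI[of _ \<phi>] exI[of _ N]) (auto simp: N_def)
qed

lemma sections_combination:
  assumes "finite I" "\<And>i. i \<in> I \<Longrightarrow> continuous_on UNIV (a i)" "\<And>i. i \<in> I \<Longrightarrow> s i \<in> sections \<xi>"
  shows "(\<lambda>y. \<Sum>i\<in>I. scl \<xi> (a i y) (s i y)) \<in> sections \<xi>"
  using continuous_map_combination[of euclidean "\<lambda>y. y" I a s] assms by (simp add: sections_def)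

lemma sections_add: "s \<in> sections \<xi> \<Longrightarrow> t \<in> sections \<xi> \<Longrightarrow> (\<lambda>y. s y + t y) \<in> sections \<xi>"
  using sections_combination[of "UNIV :: bool set" "\<lambda>_ _. 1" "\<lambda>b. if b then s else t"] by (simp add: UNIV_bool add.commute)

lemma sections_scale: "continuous_on UNIV a \<Longrightarrow> s \<in> sections \<xi> \<Longrightarrow> (\<lambda>y. scl \<xi> (a y) (s y)) \<in> sections \<xi>"
  using sections_combination[of "{()}" "\<lambda>_. a" "\<lambda>_. s"] by simp

text \<open>The members of the frame are global sections, so that operators on
  \<open>sections \<xi>\<close> apply to them; only the spanning property and the continuity of the
  coordinates are confined to \<open>N\<close>.\<close>

definition is_local_frame :: "'x set \<Rightarrow> ('d \<Rightarrow> 'x \<Rightarrow> 'v) \<Rightarrow> ('x \<Rightarrow> 'v \<Rightarrow> complex ^ 'd) \<Rightarrow> bool"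
  where "is_local_frame N s c \<longleftrightarrow> open N \<and> (\<forall>j. s j \<in> sections \<xi>) \<and>
    (\<forall>y\<in>N. \<forall>v\<in>fiber \<xi> y. (\<Sum>j\<in>UNIV. scl \<xi> (c y v $ j) (s j y)) = v) \<and>
    continuous_map (subtopology (total \<xi>) (N \<times> UNIV)) euclidean (\<lambda>(y, v). c y v)"

lemma is_local_frameD:
  assumes "is_local_frame N s c"
  shows "open N" and "s j \<in> sections \<xi>"
    and "y \<in> N \<Longrightarrow> v \<in> fiber \<xi> y \<Longrightarrow> (\<Sum>j\<in>UNIV. scl \<xi> (c y v $ j) (s j y)) = v"
    and "continuous_map (subtopology (total \<xi>) (N \<times> UNIV)) euclidean (\<lambda>(y, v). c y v)"
  using assms by (simp_all add: is_local_frame_def)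

text \<open>A chart around \<open>y0\<close> gives a local frame, made global with the bump function
  \<open>max 0 (1 - dist y0 y / e)\<close>; the coordinates in the frame have to be divided by it.\<close>

lemma local_frame:
  obtains N s c where "is_local_frame N s c" "y0 \<in> N"
proof -
  obtain U \<phi> where chart: "(U, \<phi>) \<in> charts \<xi>" and y0: "y0 \<in> U" by (rule chart_exists)
  \<comment> \<open>A closed ball inside \<open>U\<close> is needed: a point outside
    \<open>U\<close> then has a neighbourhood avoiding the ball, on which the sections vanish, so
    their extension by 0 is continuous.\<close>
  obtain e where e: "e > 0" "cball y0 e \<subseteq> U"
    using chart_open[OF chart] y0 open_contains_cball by blast
  define b :: "'x \<Rightarrow> complex" where "b y = of_real (max 0 (1 - dist y0 y / e))" for y
  define N where "N = ball y0 e"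
  define \<epsilon> where "\<epsilon> y j = inv_into (fiber \<xi> y) (\<phi> y) (axis j 1)" for y j
  define s where "s j y = (if y \<in> U then scl \<xi> (b y) (\<epsilon> y j) else 0)" for j y
  define c where "c y v = inverse (b y) *s \<phi> y v" for y v
  have b_cont: "continuous_on S b" for S
    unfolding b_def using e by (intro continuous_intros) auto
  have b_N: "b y \<noteq> 0" if "y \<in> N" for y
    using that e by (auto simp: b_def N_def simp flip: of_real_diff of_real_divide)
  have b_out: "b y = 0" if "y \<notin> cball y0 e" for y
    using that e by (auto simp: b_def field_simps)
  have \<epsilon>: "\<epsilon> y j \<in> fiber \<xi> y" "\<phi> y (\<epsilon> y j) = axis j 1" if "y \<in> U" for y j
    using chart_bij[OF chart that] unfolding \<epsilon>_def
    by (auto simp: bij_betw_def inv_into_into f_inv_into_f)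
  have s: "s j \<in> sections \<xi>" for j
    unfolding sections_def mem_Collect_eq
  proof (rule continuous_map_totalI)
    show "s j y \<in> fiber \<xi> y" for y using \<epsilon> by (simp add: s_def)
    fix y
    show "\<exists>U \<phi> N. (U, \<phi>) \<in> charts \<xi> \<and> openin euclidean N \<and> y \<in> N \<and> (\<lambda>y. y) ` N \<subseteq> U \<and>
      continuous_map (subtopology euclidean N) euclidean (\<lambda>y. \<phi> y (s j y))"
    proof (cases "y \<in> U")
      case True
      have "\<phi> y (s j y) = b y *s axis j 1" if "y \<in> U" for y
        using that \<epsilon> by (simp add: s_def linear_between_scale[OF chart_linear[OF chart]])
      moreover have "continuous_on U (\<lambda>y. b y *s axis j 1 :: complex ^ 'd)"
        using continuous_map_vector_scalar_mult[of "top_of_set U" b "\<lambda>_. axis j 1"] b_cont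
        by simp
      ultimately have "continuous_on U (\<lambda>y. \<phi> y (s j y))" by simp
      then show ?thesis
        using chart chart_open[OF chart] True by (intro exI[of _ U] exI[of _ \<phi>]) auto
    next
      case False
      obtain U' \<phi>' where chart': "(U', \<phi>') \<in> charts \<xi>" "y \<in> U'" by (rule chart_exists)
      let ?N = "U' - cball y0 e"
      have "\<phi>' y (s j y) = 0" if "y \<in> ?N" for y
        using that b_out linear_between_0[OF chart_linear[OF chart'(1)]] by (auto simp: s_def)
      then have "continuous_on ?N (\<lambda>y. \<phi>' y (s j y))"
        by (subst continuous_on_cong[OF refl, of _ _ "\<lambda>_. 0"]) auto
      moreover have "y \<notin> cball y0 e" using False e by blast
      ultimately show ?thesis
        using chart' chart_open[OF chart'(1)]
        by (intro exI[of _ U'] exI[of _ \<phi>'] exI[of _ ?N]) auto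
    qed
  qed simp
  have frame: "(\<Sum>j\<in>UNIV. scl \<xi> (c y v $ j) (s j y)) = v" if y: "y \<in> N" and v: "v \<in> fiber \<xi> y" for y v
  proof -
    have yU: "y \<in> U" using y e by (auto simp: N_def)
    have "\<phi> y (\<Sum>j\<in>UNIV. scl \<xi> (c y v $ j) (s j y)) = (\<Sum>j\<in>UNIV. c y v $ j *s \<phi> y (s j y))"
      using s by (intro linear_between_sum[OF chart_linear[OF chart yU] V.vector_space_axioms fiber_subspace])
        (auto intro: section_in_fiber)
    also have "\<dots> = (\<Sum>j\<in>UNIV. (\<phi> y v $ j) *s axis j 1)"
      using b_N[OF y] \<epsilon>[OF yU] yU
      by (intro sum.cong) (simp_all add: s_def c_def linear_between_scale[OF chart_linear[OF chart]])
    also have "\<dots> = \<phi> y v" by (rule basis_expansion)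
    finally have "\<phi> y (\<Sum>j\<in>UNIV. scl \<xi> (c y v $ j) (s j y)) = \<phi> y v" .
    then show ?thesis
      by (rule inj_onD[OF bij_betw_imp_inj_on[OF chart_bij[OF chart yU]]])
        (use v s in \<open>simp_all add: fiber_combination section_in_fiber\<close>)
  qed
  have "continuous_map (subtopology (total \<xi>) (N \<times> UNIV)) euclidean (\<lambda>(y, v). c y v)"
  proof -
    have sub: "N \<times> UNIV \<subseteq> U \<times> (UNIV :: 'v set)" using e by (auto simp: N_def)
    have "continuous_map (subtopology (total \<xi>) (N \<times> UNIV)) (top_of_set N) fst"
      by (intro continuous_map_into_subtopology continuous_map_from_subtopology continuous_map_total_fst) auto
    then have "continuous_map (subtopology (total \<xi>) (N \<times> UNIV)) euclidean ((\<lambda>y. inverse (b y)) \<circ> fst)"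
      by (rule continuous_map_compose) (auto intro!: continuous_on_inverse b_cont b_N)
    then have "continuous_map (subtopology (total \<xi>) (N \<times> UNIV)) euclidean
        (\<lambda>e. inverse (b (fst e)) *s (case e of (y, v) \<Rightarrow> \<phi> y v))"
      using continuous_map_from_subtopology_mono[OF continuous_map_chart[OF chart] sub]
      by (intro continuous_map_vector_scalar_mult) (auto simp: o_def)
    then show ?thesis by (simp add: c_def case_prod_unfold)
  qed
  then have "is_local_frame N s c"
    using s frame by (simp add: is_local_frame_def N_def)
  then show ?thesis using e by (intro that[of N s c]) (simp_all add: N_def)
qed

text \<open>The coordinates of \<open>v\<close> in a local frame at \<open>y\<close>, used as
  constant coefficients, give the section. It turns statements about sections into statements about
  vectors.\<close>

lemma section_through:
  assumes "v \<in> fiber \<xi> y"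
  obtains s where "s \<in> sections \<xi>" "s y = v"
proof -
  obtain N s c where frame: "is_local_frame N s c" and y: "y \<in> N" by (rule local_frame)
  have "(\<Sum>j\<in>UNIV. scl \<xi> (c y v $ j) (s j y)) = v" and s: "s j \<in> sections \<xi>" for j
    using is_local_frameD[OF frame] y assms by blast+
  with sections_combination[of UNIV "\<lambda>j _. c y v $ j" s] s show ?thesis
    by (intro that[of "\<lambda>z. \<Sum>j\<in>UNIV. scl \<xi> (c y v $ j) (s j z)"]) auto
qed

text \<open>An arbitrary extension of \<open>v\<close>; what is built from it is later shown to
  depend on \<open>v\<close> alone.\<close>

definition sec :: "'x \<Rightarrow> 'v \<Rightarrow> 'x \<Rightarrow> 'v"
  where "sec y v = (SOME s. s \<in> sections \<xi> \<and> s y = v)"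

lemma sec: "sec y v \<in> sections \<xi>" "sec y v y = v" if "v \<in> fiber \<xi> y"
  using someI_ex[of "\<lambda>s. s \<in> sections \<xi> \<and> s y = v"] section_through[OF that]
  unfolding sec_def by blast+

section \<open>Homomorphisms as families of functionals\<close>

lemma herm_linear: "u \<in> fiber \<xi> y \<Longrightarrow> linear_between (scl \<xi>) (fiber \<xi> y) (*) UNIV (herm \<xi> y u)"
  using hermitian by (simp add: hermitian_metric_def)

lemma herm_cnj: "u \<in> fiber \<xi> y \<Longrightarrow> v \<in> fiber \<xi> y \<Longrightarrow> herm \<xi> y v u = cnj (herm \<xi> y u v)"
  using hermitian unfolding hermitian_metric_def by blast

lemma herm_sum_left:
  assumes "finite I" "\<And>i. i \<in> I \<Longrightarrow> u i \<in> fiber \<xi> y" "v \<in> fiber \<xi> y"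
  shows "herm \<xi> y (\<Sum>i\<in>I. scl \<xi> (c i) (u i)) v = (\<Sum>i\<in>I. cnj (c i) * herm \<xi> y (u i) v)"
proof -
  have "herm \<xi> y (\<Sum>i\<in>I. scl \<xi> (c i) (u i)) v = cnj (herm \<xi> y v (\<Sum>i\<in>I. scl \<xi> (c i) (u i)))"
    using assms by (intro herm_cnj fiber_combination)
  also have "\<dots> = (\<Sum>i\<in>I. cnj (c i) * cnj (herm \<xi> y v (u i)))"
    using assms by (subst linear_between_sum[OF herm_linear V.vector_space_axioms fiber_subspace]) auto
  also have "\<dots> = (\<Sum>i\<in>I. cnj (c i) * herm \<xi> y (u i) v)"
    using assms by (intro sum.cong) (simp_all add: herm_cnj[of v])
  finally show ?thesis .
qed

text \<open>The preimage of the standard basis is an orthonormal basis of the fibre because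
  \<open>\<tau> x\<close> is isometric. It varies with \<open>x\<close>, not just with
  \<open>p x\<close>, so it is no family of sections over the quotient.\<close>

definition onb :: "'a \<Rightarrow> 'd \<Rightarrow> 'v"
  where "onb x j = inv_into (fiber \<xi> (p x)) (\<tau> x) (axis j 1)"

lemma onb_in [simp]: "onb x j \<in> fiber \<xi> (p x)" and tau_onb [simp]: "\<tau> x (onb x j) = axis j 1"
  using tau_bij[of x] unfolding onb_def by (auto simp: bij_betw_def inv_into_into f_inv_into_f)

lemma tau_injD: "u \<in> fiber \<xi> (p x) \<Longrightarrow> v \<in> fiber \<xi> (p x) \<Longrightarrow> \<tau> x u = \<tau> x v \<Longrightarrow> u = v"
  using tau_bij[of x] by (auto simp: bij_betw_def dest: inj_onD)

lemma herm_onb: "v \<in> fiber \<xi> (p x) \<Longrightarrow> herm \<xi> (p x) (onb x j) v = \<tau> x v $ j"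
  by (simp add: herm_tau axis_def if_distrib if_distribR cong: if_cong)

lemma onb_expansion:
  assumes "v \<in> fiber \<xi> (p x)"
  shows "(\<Sum>j\<in>UNIV. scl \<xi> (\<tau> x v $ j) (onb x j)) = v"
proof (rule tau_injD)
  show "\<tau> x (\<Sum>j\<in>UNIV. scl \<xi> (\<tau> x v $ j) (onb x j)) = \<tau> x v"
    by (subst linear_between_sum[OF tau_linear V.vector_space_axioms fiber_subspace])
      (simp_all add: basis_expansion)
qed (use assms in \<open>auto intro: fiber_combination\<close>)

text \<open>Pairing with the orthonormal basis recovers the \<open>\<tau>\<close>-coordinates, and
  these determine the vector.\<close>

lemma herm_ext:
  assumes "u \<in> fiber \<xi> y" "v \<in> fiber \<xi> y" "\<And>w. w \<in> fiber \<xi> y \<Longrightarrow> herm \<xi> y w u = herm \<xi> y w v"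
  shows "u = v"
proof -
  obtain x where x: "y = p x" using p_surj by auto
  show ?thesis
    using assms unfolding x by (intro tau_injD[of u x v]) (auto simp: vec_eq_iff simp flip: herm_onb)
qed

text \<open>The coordinates of \<open>v\<close> in the orthonormal basis are the conjugates of the
  values of \<open>L\<close> on it. The result has \<open>cnj (L u)\<close> because
  \<open>herm\<close> is conjugate linear in its first argument.\<close>

lemma fiber_riesz:
  assumes L: "linear_between (scl \<xi>) (fiber \<xi> y) (*) UNIV L"
  obtains v where "v \<in> fiber \<xi> y" "\<And>u. u \<in> fiber \<xi> y \<Longrightarrow> herm \<xi> y u v = cnj (L u)"
proof -
  obtain x where x: "y = p x" using p_surj by auto
  define v where "v = (\<Sum>j\<in>UNIV. scl \<xi> (cnj (L (onb x j))) (onb x j))"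
  have v: "v \<in> fiber \<xi> (p x)" unfolding v_def by (intro fiber_combination) simp
  have tau_v: "\<tau> x v = (\<chi> j. cnj (L (onb x j)))"
    unfolding v_def
    by (subst linear_between_sum[OF tau_linear V.vector_space_axioms fiber_subspace])
      (simp_all add: vec_eq_iff axis_def if_distrib cong: if_cong)
  have "herm \<xi> (p x) u v = cnj (L u)" if u: "u \<in> fiber \<xi> (p x)" for u
  proof -
    have "L u = L (\<Sum>j\<in>UNIV. scl \<xi> (\<tau> x u $ j) (onb x j))" by (simp add: onb_expansion u)
    also have "\<dots> = (\<Sum>j\<in>UNIV. \<tau> x u $ j * L (onb x j))"
      by (rule linear_between_sum[OF L[unfolded x] V.vector_space_axioms fiber_subspace]) auto
    finally show ?thesis using u v by (simp add: herm_tau tau_v)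
  qed
  with v that show ?thesis unfolding x by blast
qed

text \<open>The inverse \<open>k\<close> of the trivialization takes the coordinates back to the
  pullback, from which one projects to the total space.\<close>

lemma continuous_map_total_tauI:
  assumes u: "\<And>x. u x \<in> fiber \<xi> (p x)" and c: "continuous_on UNIV (\<lambda>x. \<tau> x (u x))"
  shows "continuous_map euclidean (total \<xi>) (\<lambda>x. (p x, u x))"
proof -
  obtain k where k: "homeomorphic_maps (pullback \<xi> p) euclidean (\<lambda>(x, _, v). (x, \<tau> x v)) k"
    using tau_homeomorphic homeomorphic_map_maps by blast
  have "continuous_map euclidean euclidean (\<lambda>x. (x, \<tau> x (u x)))"
    using c by (auto intro!: continuous_on_Pair)
  then have "continuous_map euclidean (pullback \<xi> p) (k \<circ> (\<lambda>x. (x, \<tau> x (u x))))"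
    by (rule continuous_map_compose) (use k in \<open>simp add: homeomorphic_maps_def\<close>)
  then have "continuous_map euclidean (total \<xi>) (snd \<circ> (k \<circ> (\<lambda>x. (x, \<tau> x (u x)))))"
    by (rule continuous_map_compose)
      (auto simp: pullback_def intro: continuous_map_from_subtopology continuous_map_snd)
  moreover have "k (x, \<tau> x (u x)) = (x, p x, u x)" for x
  proof -
    have "(x, p x, u x) \<in> topspace (pullback \<xi> p)"
      using u by (simp add: pullback_def in_topspace_total)
    then show ?thesis using k unfolding homeomorphic_maps_def by fastforce
  qed
  ultimately show ?thesis by (simp add: o_def)
qed

text \<open>Continuity is checked upstairs in the trivialization and descends along the quotient map
  \<open>p\<close>.\<close>

lemma sectionI_tau:
  assumes "\<And>y. s y \<in> fiber \<xi> y" "continuous_on UNIV (\<lambda>x. \<tau> x (s (p x)))"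
  shows "s \<in> sections \<xi>"
  using continuous_map_total_tauI[of "\<lambda>x. s (p x)"] assms
    continuous_map_descend[of "total \<xi>" "\<lambda>y. (y, s y)"]
  by (simp add: sections_def)

lemma continuous_map_onb: "continuous_map euclidean (total \<xi>) (\<lambda>x. (p x, onb x j))"
  by (rule continuous_map_total_tauI) auto

section \<open>Adjointable module maps and their fibrewise description\<close>

abbreviation "Hom \<equiv> Hom_S_Xi G act p \<xi>"
abbreviation "adj \<equiv> module_adjoint G act p \<xi>"
abbreviation "ip \<equiv> xi_inner G act p"

text \<open>The elements of \<open>Hom\<close> turn out to be exactly the maps given by functionals on the fibres.\<close>

definition fibrewise :: "('a \<Rightarrow> 'v \<Rightarrow> complex) \<Rightarrow> (('x \<Rightarrow> 'v) \<Rightarrow> ('a \<Rightarrow> complex)) \<Rightarrow> bool"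
  where "fibrewise \<omega> W \<longleftrightarrow> W \<in> sections \<xi> \<rightarrow>\<^sub>E Xi G act \<and>
    (\<forall>x. linear_between (scl \<xi>) (fiber \<xi> (p x)) (*) UNIV (\<omega> x)) \<and>
    (\<forall>s\<in>sections \<xi>. \<forall>x. W s x = \<omega> x (s (p x)))"

lemma fibrewiseD:
  assumes "fibrewise \<omega> W"
  shows "s \<in> sections \<xi> \<Longrightarrow> W s \<in> Xi G act"
    and "linear_between (scl \<xi>) (fiber \<xi> (p x)) (*) UNIV (\<omega> x)"
    and "s \<in> sections \<xi> \<Longrightarrow> W s x = \<omega> x (s (p x))"
  using assms by (auto simp: fibrewise_def)

lemma is_module_adjointD:
  assumes "is_module_adjoint G act p \<xi> W V" "s \<in> sections \<xi>" "f \<in> Xi G act"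
  shows "herm \<xi> y (s y) (V f y) = ip (W s) f y"
proof -
  have "ip (W s) f = sec_inner \<xi> s (V f)"
    using assms unfolding is_module_adjoint_def by blast
  then show ?thesis by (simp add: sec_inner_def)
qed

text \<open>The difference \<open>u\<close> of the two sections vanishes at \<open>p x\<close>, so
  moving \<open>W\<close> to the other side by the adjoint gives
  \<open>ip (W u) (W u) (p x) = 0\<close>. Definiteness then yields
  \<open>W u x = 0\<close>.\<close>

lemma Hom_cong:
  assumes W: "W \<in> Hom" and s: "s \<in> sections \<xi>" and t: "t \<in> sections \<xi>" and eq: "s (p x) = t (p x)"
  shows "W s x = W t x"
proof -
  obtain V where V: "is_module_adjoint G act p \<xi> W V" using W by (auto simp: Hom_S_Xi_def)
  have Xi: "W s \<in> Xi G act" if "s \<in> sections \<xi>" for s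
    using W that by (auto simp: Hom_S_Xi_def)
  \<comment> \<open>\<open>Hom\<close> provides sums and multiples by continuous functions only, so
    the difference is formed with the constant multiplier -1.\<close>
  define t' u where "t' = (\<lambda>y. scl \<xi> (-1) (t y))" and "u = (\<lambda>y. s y + t' y)"
  have t': "t' \<in> sections \<xi>" unfolding t'_def using t by (intro sections_scale) auto
  then have u: "u \<in> sections \<xi>" unfolding u_def using s by (intro sections_add)
  have "W t' = (\<lambda>x. -1 * W t x)"
    using W t unfolding Hom_S_Xi_def t'_def by (auto dest!: spec[of _ "\<lambda>_. -1"])
  moreover have "W u = (\<lambda>x. W s x + W t' x)"
    using W s t' unfolding Hom_S_Xi_def u_def by blast
  ultimately have Wu: "W u x = W s x - W t x" by simp
  have "ip (W u) (W u) (p x) = herm \<xi> (p x) (u (p x)) (V (W u) (p x))"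
    by (rule is_module_adjointD[OF V u Xi[OF u], symmetric])
  also have "u (p x) = 0" using eq by (simp add: u_def t'_def)
  also have "herm \<xi> (p x) 0 (V (W u) (p x)) = 0"
    using herm_sum_left[of "{}" _ "p x" "V (W u) (p x)"] V Xi[OF u]
    by (auto simp: is_module_adjoint_def intro: section_in_fiber)
  finally have "W u x = 0"
    using orbit_sum_self_eq_0D[OF Xi[OF u]] by (simp add: xi_inner_p)
  then show ?thesis using Wu by simp
qed

text \<open>The functional at \<open>x\<close> evaluates \<open>W\<close> on any section extending
  the given vector. Independence of the extension makes it linear.\<close>

lemma Hom_fibrewise:
  assumes W: "W \<in> Hom"
  obtains \<omega> where "fibrewise \<omega> W"
proof -
  define \<omega> where "\<omega> x v = W (sec (p x) v) x" for x v
  have eq: "W s x = \<omega> x (s (p x))" if "s \<in> sections \<xi>" for s x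
    unfolding \<omega>_def using that sec[OF section_in_fiber[OF that]] by (intro Hom_cong[OF W]) auto
  have "linear_between (scl \<xi>) (fiber \<xi> (p x)) (*) UNIV (\<omega> x)" for x
    unfolding linear_between_def
  proof (intro conjI ballI allI)
    fix u v assume u: "u \<in> fiber \<xi> (p x)" and v: "v \<in> fiber \<xi> (p x)"
    have "W (\<lambda>y. sec (p x) u y + sec (p x) v y) = (\<lambda>z. W (sec (p x) u) z + W (sec (p x) v) z)"
      using W sec[OF u] sec[OF v] by (simp add: Hom_S_Xi_def)
    moreover have "W (\<lambda>y. sec (p x) u y + sec (p x) v y) x = \<omega> x (u + v)"
      using sec[OF u] sec[OF v] by (subst eq) (auto intro: sections_add)
    ultimately show "\<omega> x (u + v) = \<omega> x u + \<omega> x v" by (simp add: \<omega>_def)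
  next
    fix c v assume v: "v \<in> fiber \<xi> (p x)"
    have "W (\<lambda>y. scl \<xi> c (sec (p x) v y)) = (\<lambda>z. c * W (sec (p x) v) z)"
      using W sec[OF v] by (auto simp: Hom_S_Xi_def dest!: spec[of _ "\<lambda>_. c"])
    moreover have "W (\<lambda>y. scl \<xi> c (sec (p x) v y)) x = \<omega> x (scl \<xi> c v)"
      using sec[OF v] by (subst eq) (auto intro: sections_scale)
    ultimately show "\<omega> x (scl \<xi> c v) = c * \<omega> x v" by (simp add: \<omega>_def)
  qed simp
  then have "fibrewise \<omega> W" using W eq by (simp add: fibrewise_def Hom_S_Xi_def)
  then show ?thesis by (rule that)
qed

text \<open>All points of the orbit of \<open>x\<close> lie over \<open>p x\<close>, so the
  functionals \<open>\<omega> (act g x)\<close> live on one and the same fibre and can be summed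
  with weights \<open>cnj (f (act g x))\<close>. Convergence at a vector comes from a section
  through it.\<close>

lemma xi_inner_functional:
  assumes f: "f \<in> Xi G act" and W: "fibrewise \<omega> W"
  obtains L where "linear_between (scl \<xi>) (fiber \<xi> y) (*) UNIV L"
    and "\<And>s. s \<in> sections \<xi> \<Longrightarrow> ip f (W s) y = L (s y)"
proof -
  obtain x where x: "y = p x" using p_surj by auto
  define L where "L v = (\<Sum>\<^sub>\<infinity>g\<in>carrier G. cnj (f (act g x)) * \<omega> (act g x) v)" for v
  have eq: "W s (act g x) = \<omega> (act g x) (s (p x))" if "s \<in> sections \<xi>" "g \<in> carrier G" for s g
    using W that unfolding fibrewise_def by (metis p_act)
  have \<omega>: "linear_between (scl \<xi>) (fiber \<xi> (p x)) (*) UNIV (\<omega> (act g x))" if "g \<in> carrier G" for g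
    using W that unfolding fibrewise_def by (metis p_act)
  have summable: "(\<lambda>g. cnj (f (act g x)) * \<omega> (act g x) v) summable_on carrier G"
    if v: "v \<in> fiber \<xi> (p x)" for v
  proof -
    obtain s where s: "s \<in> sections \<xi>" "s (p x) = v" using section_through[OF v] .
    then have "W s \<in> Xi G act" using W by (auto simp: fibrewise_def)
    from Xi_product_summable[OF f this, of x] show ?thesis
      using s eq by (simp cong: summable_on_cong)
  qed
  have "linear_between (scl \<xi>) (fiber \<xi> (p x)) (*) UNIV L"
    unfolding linear_between_def
  proof (intro conjI ballI allI)
    fix u v assume uv: "u \<in> fiber \<xi> (p x)" "v \<in> fiber \<xi> (p x)"
    show "L (u + v) = L u + L v"
      unfolding L_def infsum_add[OF summable[OF uv(1)] summable[OF uv(2)], symmetric]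
      using uv by (intro infsum_cong) (simp add: linear_between_add[OF \<omega>] distrib_left)
  next
    fix c v assume v: "v \<in> fiber \<xi> (p x)"
    show "L (scl \<xi> c v) = c * L v"
      unfolding L_def infsum_cmult_right'[symmetric]
      using v by (intro infsum_cong) (simp add: linear_between_scale[OF \<omega>] mult_ac)
  qed simp
  moreover have "ip f (W s) (p x) = L (s (p x))" if "s \<in> sections \<xi>" for s
    unfolding xi_inner_p orbit_sum_def L_def using eq[OF that] by (intro infsum_cong) simp
  ultimately show ?thesis using that unfolding x by blast
qed

text \<open>The Riesz representation constructs the adjoint fibre by fibre; what remains is
  continuity of the resulting sections.\<close>

lemma fibrewise_adjoint:
  assumes W: "fibrewise \<omega> W"
  obtains V where "is_module_adjoint G act p \<xi> W V"
proof -
  have Xi: "W s \<in> Xi G act" if "s \<in> sections \<xi>" for s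
    using W that by (auto simp: fibrewise_def)
  have "\<exists>v\<in>fiber \<xi> y. \<forall>s\<in>sections \<xi>. ip (W s) f y = herm \<xi> y (s y) v" if f: "f \<in> Xi G act" for f y
  proof -
    obtain L where L: "linear_between (scl \<xi>) (fiber \<xi> y) (*) UNIV L"
      "\<And>s. s \<in> sections \<xi> \<Longrightarrow> ip f (W s) y = L (s y)"
      using xi_inner_functional[OF f W] by metis
    obtain v where v: "v \<in> fiber \<xi> y" "\<And>u. u \<in> fiber \<xi> y \<Longrightarrow> herm \<xi> y u v = cnj (L u)"
      using fiber_riesz[OF L(1)] by metis
    then have "ip (W s) f y = herm \<xi> y (s y) v" if "s \<in> sections \<xi>" for s
      using L(2)[OF that] section_in_fiber[OF that] xi_inner_cnj by metis
    with v show ?thesis by blast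
  qed
  then obtain V0 where V0: "\<And>f y. f \<in> Xi G act \<Longrightarrow> V0 f y \<in> fiber \<xi> y"
    "\<And>f y s. f \<in> Xi G act \<Longrightarrow> s \<in> sections \<xi> \<Longrightarrow> ip (W s) f y = herm \<xi> y (s y) (V0 f y)"
    by metis
  have "V0 f \<in> sections \<xi>" if f: "f \<in> Xi G act" for f
  proof (rule sectionI_tau)
    show "V0 f y \<in> fiber \<xi> y" for y using V0 f by blast
    \<comment> \<open>These pairings are the \<open>\<tau>\<close>-coordinates of
      \<open>V0 f\<close>. The adjoint identity speaks about sections, so \<open>onb x j\<close> is
      expanded in a local frame of global sections \<open>s i\<close>; this leaves continuous
      coefficients times the continuous functions \<open>ip (W (s i)) f\<close>.\<close>
    have comp: "continuous_map euclidean euclidean (\<lambda>x. herm \<xi> (p x) (onb x j) (V0 f (p x)))" for j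
    proof (rule continuous_map_locally)
      fix x0 :: 'a
      obtain N s c where frame: "is_local_frame N s c" and x0: "p x0 \<in> N" by (rule local_frame)
      note N = is_local_frameD(1)[OF frame] x0 and s = is_local_frameD(2)[OF frame]
        and expand = is_local_frameD(3)[OF frame] and c = is_local_frameD(4)[OF frame]
      define P where "P = p -` N"
      have P: "open P" "x0 \<in> P"
        using N continuous_on_p[of UNIV] by (auto simp: P_def open_vimage)
      have "continuous_map (top_of_set P) (subtopology (total \<xi>) (N \<times> UNIV)) (\<lambda>x. (p x, onb x j))"
        by (intro continuous_map_into_subtopology continuous_map_from_subtopology continuous_map_onb)
          (auto simp: P_def)
      from continuous_map_compose[OF this c]
      have c': "continuous_on P (\<lambda>x. c (p x) (onb x j))" by (simp add: o_def)
      have "continuous_on P (\<lambda>x. \<Sum>i\<in>UNIV. cnj (c (p x) (onb x j) $ i) * ip (W (s i)) f (p x))"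
        by (intro continuous_intros c' continuous_on_compose2[OF continuous_on_xi_inner continuous_on_p])
          (use Xi s f in auto)
      moreover have "herm \<xi> (p x) (onb x j) (V0 f (p x)) =
          (\<Sum>i\<in>UNIV. cnj (c (p x) (onb x j) $ i) * ip (W (s i)) f (p x))" if "x \<in> P" for x
      proof -
        have "herm \<xi> (p x) (onb x j) (V0 f (p x)) =
            herm \<xi> (p x) (\<Sum>i\<in>UNIV. scl \<xi> (c (p x) (onb x j) $ i) (s i (p x))) (V0 f (p x))"
          using expand[of "p x" "onb x j"] that by (simp add: P_def)
        also have "\<dots> = (\<Sum>i\<in>UNIV. cnj (c (p x) (onb x j) $ i) * herm \<xi> (p x) (s i (p x)) (V0 f (p x)))"
          using s V0(1)[OF f] by (intro herm_sum_left) (auto intro: section_in_fiber)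
        finally show ?thesis using V0(2)[OF f s] by simp
      qed
      ultimately have "continuous_on P (\<lambda>x. herm \<xi> (p x) (onb x j) (V0 f (p x)))"
        by (simp cong: continuous_on_cong)
      then show "\<exists>P. openin euclidean P \<and> x0 \<in> P \<and>
          continuous_map (subtopology euclidean P) euclidean (\<lambda>x. herm \<xi> (p x) (onb x j) (V0 f (p x)))"
        using P by auto
    qed
    have "continuous_on UNIV (\<lambda>x. \<chi> j. herm \<xi> (p x) (onb x j) (V0 f (p x)))"
      using comp by (intro continuous_on_vec_lambda) simp
    moreover have "(\<chi> j. herm \<xi> (p x) (onb x j) (V0 f (p x))) = \<tau> x (V0 f (p x))" for x
      using V0(1)[OF f] by (simp add: herm_onb vec_eq_iff)
    ultimately show "continuous_on UNIV (\<lambda>x. \<tau> x (V0 f (p x)))" by simp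
  qed
  then have "is_module_adjoint G act p \<xi> W (restrict V0 (Xi G act))"
    using V0(2) by (auto simp: is_module_adjoint_def sec_inner_def)
  then show ?thesis by (rule that)
qed

lemma fibrewise_Hom:
  assumes W: "fibrewise \<omega> W"
  shows "W \<in> Hom"
proof -
  obtain V where "is_module_adjoint G act p \<xi> W V" using fibrewise_adjoint[OF W] .
  moreover have "W (\<lambda>y. s y + t y) = (\<lambda>x. W s x + W t x)" if "s \<in> sections \<xi>" "t \<in> sections \<xi>" for s t
    using that
    by (auto simp: fibrewiseD[OF W] sections_add section_in_fiber linear_between_add[OF fibrewiseD(2)[OF W]])
  moreover have "W (\<lambda>y. scl \<xi> (a y) (s y)) = (\<lambda>x. a (p x) * W s x)"
    if "continuous_on UNIV a" "s \<in> sections \<xi>" for a s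
    using that
    by (auto simp: fibrewiseD[OF W] sections_scale section_in_fiber linear_between_scale[OF fibrewiseD(2)[OF W]])
  ultimately show ?thesis using W unfolding Hom_S_Xi_def fibrewise_def by blast
qed

text \<open>Existence is part of \<open>Hom\<close>. For uniqueness, the sections reach every vector
  of a fibre, so their pairings with \<open>V f\<close> determine it, and outside \<open>Xi\<close>
  the adjoint is fixed by extensionality.\<close>

lemma module_adjoint:
  assumes W: "W \<in> Hom"
  shows "is_module_adjoint G act p \<xi> W (adj W)"
  unfolding module_adjoint_def
proof (rule theI'[of "is_module_adjoint G act p \<xi> W"])
  have "V = V'" if V: "is_module_adjoint G act p \<xi> W V" and V': "is_module_adjoint G act p \<xi> W V'" for V V'
  proof (rule PiE_ext)
    show "V \<in> Xi G act \<rightarrow>\<^sub>E sections \<xi>" "V' \<in> Xi G act \<rightarrow>\<^sub>E sections \<xi>"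
      using V V' by (auto simp: is_module_adjoint_def)
    fix f assume f: "f \<in> Xi G act"
    have in_sections: "V f \<in> sections \<xi>" "V' f \<in> sections \<xi>"
      using V V' f by (auto simp: is_module_adjoint_def)
    show "V f = V' f"
    proof (rule ext, rule herm_ext)
      fix y w assume "w \<in> fiber \<xi> y"
      then obtain s where s: "s \<in> sections \<xi>" "s y = w" by (rule section_through)
      show "herm \<xi> y w (V f y) = herm \<xi> y w (V' f y)"
        using is_module_adjointD[OF V s(1) f, of y] is_module_adjointD[OF V' s(1) f, of y] s(2) by simp
    qed (use in_sections in \<open>auto intro: section_in_fiber\<close>)
  qed
  then show "\<exists>!V. is_module_adjoint G act p \<xi> W V"
    using W unfolding Hom_S_Xi_def by blast
qed

lemma adj_Xi: "W \<in> Hom \<Longrightarrow> f \<in> Xi G act \<Longrightarrow> adj W f \<in> sections \<xi>"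
  using module_adjoint[of W] by (auto simp: is_module_adjoint_def)

lemma herm_adj: "W \<in> Hom \<Longrightarrow> f \<in> Xi G act \<Longrightarrow> s \<in> sections \<xi> \<Longrightarrow>
    herm \<xi> y (s y) (adj W f y) = ip (W s) f y"
  by (rule is_module_adjointD[where V = "adj W" and W = W and s = s and f = f and y = y, OF module_adjoint])

section \<open>Bundle endomorphisms induced by operators on sections\<close>

lemma bundle_End_ext:
  assumes "h \<in> bundle_End \<xi>" "h' \<in> bundle_End \<xi>"
    and "\<And>s y. s \<in> sections \<xi> \<Longrightarrow> h y (s y) = h' y (s y)"
  shows "h = h'"
proof
  fix y
  show "h y = h' y"
  proof (rule extensionalityI[of _ "fiber \<xi> y"])
    fix v assume "v \<in> fiber \<xi> y"
    then obtain s where "s \<in> sections \<xi>" "s y = v" by (rule section_through)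
    then show "h y v = h' y v" using assms(3) by blast
  qed (use assms in \<open>auto simp: bundle_End_def\<close>)
qed

text \<open>Justifies the definite description in \<open>endo_of\<close>. For continuity on the
  total space, a vector is written in a local frame as \<open>v = \<Sum> c j s j\<close>; its image
  is the combination of the continuous sections \<open>F (s j)\<close> with the same continuous
  coordinates.\<close>

lemma endo_of:
  assumes F: "\<And>s. s \<in> sections \<xi> \<Longrightarrow> F s \<in> sections \<xi>"
    and k: "\<And>y. linear_between (scl \<xi>) (fiber \<xi> y) (scl \<xi>) (fiber \<xi> y) (k y)"
    and Fk: "\<And>s y. s \<in> sections \<xi> \<Longrightarrow> F s y = k y (s y)"
  shows "endo_of \<xi> F \<in> bundle_End \<xi> \<and> (\<forall>s\<in>sections \<xi>. \<forall>y. F s y = endo_of \<xi> F y (s y))"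
  unfolding endo_of_def
proof (rule theI'[of "\<lambda>h. h \<in> bundle_End \<xi> \<and> (\<forall>s\<in>sections \<xi>. \<forall>y. F s y = h y (s y))"])
  define h where "h y = restrict (k y) (fiber \<xi> y)" for y
  have "continuous_map (total \<xi>) (total \<xi>) (\<lambda>(y, v). (y, h y v))"
  proof (rule continuous_map_locally)
    fix e assume e: "e \<in> topspace (total \<xi>)"
    obtain N s c where frame: "is_local_frame N s c" and e_N: "fst e \<in> N" by (rule local_frame)
    note N = is_local_frameD(1)[OF frame] e_N and s = is_local_frameD(2)[OF frame]
      and expand = is_local_frameD(3)[OF frame] and c = is_local_frameD(4)[OF frame]
    let ?O = "{e \<in> topspace (total \<xi>). fst e \<in> N}"
    have O: "subtopology (total \<xi>) ?O = subtopology (total \<xi>) (N \<times> UNIV)"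
    proof -
      have "?O = topspace (total \<xi>) \<inter> N \<times> UNIV" by auto
      then show ?thesis by (simp add: subtopology_restrict)
    qed
    have "openin (total \<xi>) ?O"
      using continuous_map_total_fst N by (intro openin_continuous_map_preimage) auto
    moreover have "continuous_map (subtopology (total \<xi>) (N \<times> UNIV)) (total \<xi>) (\<lambda>(y, v). (y, h y v))"
    proof (rule continuous_map_eq)
      have "continuous_map (subtopology (total \<xi>) (N \<times> UNIV)) euclidean (\<lambda>e. c (fst e) (snd e) $ j)" for j
        using c unfolding continuous_map_atin limitin_canonical_iff
        by (auto simp: case_prod_unfold intro: tendsto_vec_nth)
      then show "continuous_map (subtopology (total \<xi>) (N \<times> UNIV)) (total \<xi>)
          (\<lambda>e. (fst e, \<Sum>j\<in>UNIV. scl \<xi> (c (fst e) (snd e) $ j) (F (s j) (fst e))))"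
        using s F by (intro continuous_map_combination continuous_map_from_subtopology[OF continuous_map_total_fst]) auto
      fix e assume "e \<in> topspace (subtopology (total \<xi>) (N \<times> UNIV))"
      then obtain y v where e: "e = (y, v)" "y \<in> N" "v \<in> fiber \<xi> y"
        by (cases e) (auto simp: in_topspace_total)
      have "h y v = k y (\<Sum>j\<in>UNIV. scl \<xi> (c y v $ j) (s j y))"
        using e expand[of y v] by (simp add: h_def)
      also have "\<dots> = (\<Sum>j\<in>UNIV. scl \<xi> (c y v $ j) (F (s j) y))"
        using s by (subst linear_between_sum[OF k V.vector_space_axioms fiber_subspace])
          (auto simp: Fk section_in_fiber)
      finally show "(fst e, \<Sum>j\<in>UNIV. scl \<xi> (c (fst e) (snd e) $ j) (F (s j) (fst e))) =
          (case e of (y, v) \<Rightarrow> (y, h y v))"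
        by (simp add: e)
    qed
    ultimately show "\<exists>N. openin (total \<xi>) N \<and> e \<in> N \<and>
        continuous_map (subtopology (total \<xi>) N) (total \<xi>) (\<lambda>(y, v). (y, h y v))"
      using e N unfolding O[symmetric] by blast
  qed
  moreover have "linear_between (scl \<xi>) (fiber \<xi> y) (scl \<xi>) (fiber \<xi> y) (h y)" for y
    using k[of y] by (auto simp: linear_between_def h_def)
  ultimately have h: "h \<in> bundle_End \<xi>" by (simp add: bundle_End_def h_def)
  have hF: "\<forall>s\<in>sections \<xi>. \<forall>y. F s y = h y (s y)"
    by (simp add: h_def Fk section_in_fiber)
  show "\<exists>!h. h \<in> bundle_End \<xi> \<and> (\<forall>s\<in>sections \<xi>. \<forall>y. F s y = h y (s y))"
    using h hF bundle_End_ext by (intro ex1I[of _ h]) metis+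
qed

text \<open>Describes the endomorphism by its pairings with vectors of the fibre, the form in which
  the two sides of the main identity are compared.\<close>

lemma endo_of_adj:
  assumes W1: "W1 \<in> Hom" and W2: "W2 \<in> Hom"
  shows "endo_of \<xi> (adj W1 \<circ> W2) \<in> bundle_End \<xi>"
    and "s \<in> sections \<xi> \<Longrightarrow> t \<in> sections \<xi> \<Longrightarrow>
      herm \<xi> y (t y) (endo_of \<xi> (adj W1 \<circ> W2) y (s y)) = ip (W1 t) (W2 s) y"
proof -
  have Xi: "W1 s \<in> Xi G act" "W2 s \<in> Xi G act" if "s \<in> sections \<xi>" for s
    using W1 W2 that by (auto simp: Hom_S_Xi_def)
  obtain \<omega> where \<omega>: "fibrewise \<omega> W2" using Hom_fibrewise[OF W2] .
  define F where "F = adj W1 \<circ> W2"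
  have F: "F s \<in> sections \<xi>" if "s \<in> sections \<xi>" for s
    using that Xi by (simp add: F_def adj_Xi[OF W1])
  have herm_F: "herm \<xi> y (t y) (F s y) = ip (W1 t) (W2 s) y" if "s \<in> sections \<xi>" "t \<in> sections \<xi>" for s t y
    using that Xi by (simp add: F_def herm_adj[OF W1])
  define k where "k y v = F (sec y v) y" for y v
  have k_in: "k y v \<in> fiber \<xi> y" if "v \<in> fiber \<xi> y" for y v
    using section_in_fiber[OF F[OF sec(1)[OF that]]] by (simp add: k_def)
  \<comment> \<open>With \<open>w\<close> extended to a section \<open>t\<close>, the pairing
    becomes \<open>ip (W1 t) (W2 s) y\<close>, a linear functional \<open>L\<close> of the single
    vector \<open>s y\<close>. The same \<open>L\<close> serves \<open>F\<close> and
    \<open>k\<close>, so \<open>k\<close> is independent of the extension used to define it and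
    inherits linearity by \<open>herm_ext\<close>.\<close>
  have rep: "\<exists>L. linear_between (scl \<xi>) (fiber \<xi> y) (*) UNIV L \<and>
      (\<forall>s\<in>sections \<xi>. herm \<xi> y w (F s y) = L (s y)) \<and> (\<forall>v\<in>fiber \<xi> y. herm \<xi> y w (k y v) = L v)"
    if w: "w \<in> fiber \<xi> y" for y w
  proof -
    obtain t where t: "t \<in> sections \<xi>" "t y = w" using section_through[OF w] .
    obtain L where L: "linear_between (scl \<xi>) (fiber \<xi> y) (*) UNIV L"
      "\<And>s. s \<in> sections \<xi> \<Longrightarrow> ip (W1 t) (W2 s) y = L (s y)"
      using xi_inner_functional[OF Xi(1)[OF t(1)] \<omega>] by metis
    have "herm \<xi> y w (F s y) = L (s y)" if "s \<in> sections \<xi>" for s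
      using herm_F[OF that t(1), of y] L(2)[OF that] t by simp
    then show ?thesis using L(1) sec unfolding k_def by metis
  qed
  have Fk: "F s y = k y (s y)" if "s \<in> sections \<xi>" for s y
  proof (rule herm_ext)
    show "herm \<xi> y w (F s y) = herm \<xi> y w (k y (s y))" if "w \<in> fiber \<xi> y" for w
      using rep[OF that] section_in_fiber[OF \<open>s \<in> sections \<xi>\<close>] \<open>s \<in> sections \<xi>\<close> by metis
  qed (use that F k_in in \<open>auto intro: section_in_fiber\<close>)
  have k: "linear_between (scl \<xi>) (fiber \<xi> y) (scl \<xi>) (fiber \<xi> y) (k y)" for y
    unfolding linear_between_def
  proof (intro conjI ballI allI)
    show "k y \<in> fiber \<xi> y \<rightarrow> fiber \<xi> y" using k_in by blast
    fix u v assume uv: "u \<in> fiber \<xi> y" "v \<in> fiber \<xi> y"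
    show "k y (u + v) = k y u + k y v"
    proof (rule herm_ext)
      fix w assume w: "w \<in> fiber \<xi> y"
      from rep[OF w] obtain L where L: "linear_between (scl \<xi>) (fiber \<xi> y) (*) UNIV L"
        "\<forall>v\<in>fiber \<xi> y. herm \<xi> y w (k y v) = L v" by blast
      then show "herm \<xi> y w (k y (u + v)) = herm \<xi> y w (k y u + k y v)"
        using uv k_in by (simp add: linear_between_add[OF herm_linear[OF w]] linear_between_add[OF L(1)])
    qed (use uv k_in in auto)
  next
    fix c v assume v: "v \<in> fiber \<xi> y"
    show "k y (scl \<xi> c v) = scl \<xi> c (k y v)"
    proof (rule herm_ext)
      fix w assume w: "w \<in> fiber \<xi> y"
      from rep[OF w] obtain L where L: "linear_between (scl \<xi>) (fiber \<xi> y) (*) UNIV L"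
        "\<forall>v\<in>fiber \<xi> y. herm \<xi> y w (k y v) = L v" by blast
      then show "herm \<xi> y w (k y (scl \<xi> c v)) = herm \<xi> y w (scl \<xi> c (k y v))"
        using v k_in by (simp add: linear_between_scale[OF herm_linear[OF w]] linear_between_scale[OF L(1)])
    qed (use v k_in in auto)
  qed
  have endo: "endo_of \<xi> F \<in> bundle_End \<xi> \<and> (\<forall>s\<in>sections \<xi>. \<forall>y. F s y = endo_of \<xi> F y (s y))"
    using F k Fk by (rule endo_of)
  then show "endo_of \<xi> (adj W1 \<circ> W2) \<in> bundle_End \<xi>" by (simp add: F_def)
  show "herm \<xi> y (t y) (endo_of \<xi> (adj W1 \<circ> W2) y (s y)) = ip (W1 t) (W2 s) y"
    if "s \<in> sections \<xi>" "t \<in> sections \<xi>"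
    using endo herm_F[OF that] that(1) unfolding F_def by metis
qed

end

section \<open>The refinement operator and the transfer operator\<close>

locale refinement_setting = trivialized_bundle G act p A rt r q gs \<xi> \<tau>
  for G :: "('g, 'b) monoid_scheme"
    and act :: "'g \<Rightarrow> 'a::metric_space \<Rightarrow> 'a"
    and p :: "'a \<Rightarrow> 'x::metric_space"
    and A rt r q gs
    and \<xi> :: "('x, 'v::ab_group_add, 'd::finite) vbundle"
    and \<tau> +
  fixes m :: "'x \<Rightarrow> 'v \<Rightarrow> 'v"
  assumes lipschitz_map: "lipschitz_bundle_map \<xi> r m"
begin

abbreviation "M \<equiv> refine rt r \<xi> m"
abbreviation "R \<equiv> transfer act p rt r q gs \<xi> m"

lemma m_linear: "linear_between (scl \<xi>) (fiber \<xi> (r y)) (scl \<xi>) (fiber \<xi> y) (m y)"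
  using lipschitz_map by (simp add: lipschitz_bundle_map_def)

lemma sections_refine:
  assumes s: "s \<in> sections \<xi>"
  shows "(\<lambda>y. m y (s (r y))) \<in> sections \<xi>"
proof -
  have "continuous_map euclidean (total \<xi>) ((\<lambda>y. (y, s y)) \<circ> r)"
    by (rule continuous_map_compose[of _ euclidean]) (use s continuous_on_r in \<open>auto simp: sections_def\<close>)
  then have "continuous_map euclidean (prod_topology euclidean (total \<xi>)) (\<lambda>y. (y, r y, s (r y)))"
    by (intro continuous_map_pairedI) (auto simp: o_def)
  then have "continuous_map euclidean (pullback \<xi> r) (\<lambda>y. (y, r y, s (r y)))"
    unfolding pullback_def by (intro continuous_map_into_subtopology) auto
  moreover have "continuous_map (pullback \<xi> r) (total \<xi>) (\<lambda>(y, _, v). (y, m y v))"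
    using lipschitz_map by (simp add: lipschitz_bundle_map_def)
  ultimately have "continuous_map euclidean (total \<xi>) ((\<lambda>(y, _, v). (y, m y v)) \<circ> (\<lambda>y. (y, r y, s (r y))))"
    by (rule continuous_map_compose)
  then show ?thesis by (simp add: sections_def o_def)
qed

lemma M_apply: "s \<in> sections \<xi> \<Longrightarrow> M W s = W (\<lambda>y. m y (s (r y))) \<circ> rti"
  by (simp add: refine_def)

text \<open>The refinement operator composes functionals: \<open>m (p (rti x))\<close> maps the
  fibre over \<open>r (p (rti x)) = p x\<close> to the fibre over \<open>p (rti x)\<close>, where
  the functional of \<open>W\<close> at \<open>rti x\<close> is applied.\<close>

lemma M_Hom:
  assumes "W \<in> Hom"
  shows "M W \<in> Hom"
proof -
  obtain \<omega> where W: "fibrewise \<omega> W" using Hom_fibrewise[OF assms] .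
  define \<omega>' where "\<omega>' x v = \<omega> (rti x) (m (p (rti x)) v)" for x v
  have r: "r (p (rti x)) = p x" for x by (simp add: r_p)
  have "M W s \<in> Xi G act" if "s \<in> sections \<xi>" for s
    unfolding M_apply[OF that]
    using W sections_refine[OF that] by (intro Xi_compose_rti) (auto simp: fibrewise_def)
  then have "M W \<in> sections \<xi> \<rightarrow>\<^sub>E Xi G act"
    by (auto simp: refine_def)
  moreover have "linear_between (scl \<xi>) (fiber \<xi> (p x)) (*) UNIV (\<omega>' x)" for x
  proof -
    have \<omega>: "linear_between (scl \<xi>) (fiber \<xi> (p (rti x))) (*) UNIV (\<omega> (rti x))"
      using W by (simp add: fibrewise_def)
    have m: "linear_between (scl \<xi>) (fiber \<xi> (p x)) (scl \<xi>) (fiber \<xi> (p (rti x))) (m (p (rti x)))"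
      using m_linear[of "p (rti x)"] by (simp add: r)
    show ?thesis
      unfolding linear_between_def \<omega>'_def
      by (simp add: linear_between_add[OF m] linear_between_scale[OF m] linear_between_in[OF m]
          linear_between_add[OF \<omega>] linear_between_scale[OF \<omega>])
  qed
  moreover have "M W s x = \<omega>' x (s (p x))" if "s \<in> sections \<xi>" for s x
    using W sections_refine[OF that] that by (simp add: M_apply fibrewise_def \<omega>'_def r)
  ultimately have "fibrewise \<omega>' (M W)" by (simp add: fibrewise_def)
  then show ?thesis by (rule fibrewise_Hom)
qed

text \<open>Riesz representation of the functional
  \<open>u \<mapsto> herm \<xi> y w (m y u)\<close>; uniqueness is nondegeneracy of the
  metric.\<close>

lemma bundle_map_adjoint:
  assumes w: "w \<in> fiber \<xi> y"
  shows "bundle_map_adjoint \<xi> r m y w \<in> fiber \<xi> (r y) \<and>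
    (\<forall>u\<in>fiber \<xi> (r y). herm \<xi> y (m y u) w = herm \<xi> (r y) u (bundle_map_adjoint \<xi> r m y w))"
  unfolding bundle_map_adjoint_def
proof (rule theI'[of "\<lambda>v. v \<in> fiber \<xi> (r y) \<and> (\<forall>u\<in>fiber \<xi> (r y). herm \<xi> y (m y u) w = herm \<xi> (r y) u v)"])
  have m: "m y u \<in> fiber \<xi> y" if "u \<in> fiber \<xi> (r y)" for u
    using m_linear that by (rule linear_between_in)
  have "linear_between (scl \<xi>) (fiber \<xi> (r y)) (*) UNIV (\<lambda>u. herm \<xi> y w (m y u))"
    unfolding linear_between_def
    using m by (simp add: linear_between_add[OF m_linear] linear_between_scale[OF m_linear]
        linear_between_add[OF herm_linear[OF w]] linear_between_scale[OF herm_linear[OF w]])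
  then obtain v where v: "v \<in> fiber \<xi> (r y)"
    "\<And>u. u \<in> fiber \<xi> (r y) \<Longrightarrow> herm \<xi> (r y) u v = cnj (herm \<xi> y w (m y u))"
    using fiber_riesz by blast
  have eq: "herm \<xi> y (m y u) w = herm \<xi> (r y) u v" if "u \<in> fiber \<xi> (r y)" for u
    using that v(2) herm_cnj[OF w m[OF that]] by simp
  show "\<exists>!v. v \<in> fiber \<xi> (r y) \<and> (\<forall>u\<in>fiber \<xi> (r y). herm \<xi> y (m y u) w = herm \<xi> (r y) u v)"
    using v(1) eq by (intro ex1I[of _ v]) (auto intro!: herm_ext[of _ "r y" v])
qed

lemma transfer_adj:
  assumes W1: "W1 \<in> Hom" and W2: "W2 \<in> Hom"
  shows "R (endo_of \<xi> (adj W1 \<circ> W2)) = endo_of \<xi> (adj (M W1) \<circ> M W2)"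
proof
  fix y
  define h where "h = endo_of \<xi> (adj W1 \<circ> W2)"
  define h' where "h' = endo_of \<xi> (adj (M W1) \<circ> M W2)"
  have h: "h \<in> bundle_End \<xi>" and h': "h' \<in> bundle_End \<xi>"
    using endo_of_adj(1) M_Hom W1 W2 by (auto simp: h_def h'_def)
  have h_in: "h y v \<in> fiber \<xi> y" "h' y v \<in> fiber \<xi> y" if "v \<in> fiber \<xi> y" for y v
    using h h' that unfolding bundle_End_def by (blast intro: linear_between_in)+
  have Xi: "W1 s \<in> Xi G act" "W2 s \<in> Xi G act" if "s \<in> sections \<xi>" for s
    using W1 W2 that by (auto simp: Hom_S_Xi_def)
  \<comment> \<open>This is the preimage chosen in \<open>transfer\<close>, so the sum defining
    \<open>R h y v\<close> unfolds over the points \<open>z i\<close> literally.\<close>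
  define x where "x = inv_into UNIV p y"
  have px: "p x = y" using p_surj by (simp add: x_def surj_f_inv_f)
  define z where "z i = p (ps i x)" for i
  have rz: "r (z i) = y" if "i \<in> {1..q}" for i using r_p_psi[OF that, of x] px by (simp add: z_def)
  have "R h y v = h' y v" if v: "v \<in> fiber \<xi> y" for v
  proof (rule herm_ext)
    have Rh: "R h y v = (\<Sum>i=1..q. bundle_map_adjoint \<xi> r m (z i) (h (z i) (m (z i) v)))"
      using v by (simp add: transfer_def Let_def z_def x_def)
    have adj_in: "bundle_map_adjoint \<xi> r m (z i) (h (z i) (m (z i) v)) \<in> fiber \<xi> y"
      and adj_eq: "u \<in> fiber \<xi> y \<Longrightarrow>
        herm \<xi> y u (bundle_map_adjoint \<xi> r m (z i) (h (z i) (m (z i) v))) =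
        herm \<xi> (z i) (m (z i) u) (h (z i) (m (z i) v))" if i: "i \<in> {1..q}" for i u
      using bundle_map_adjoint[OF h_in(1)[OF linear_between_in[OF m_linear]], of v "z i"] v rz[OF i]
      by auto
    show "R h y v \<in> fiber \<xi> y"
      unfolding Rh by (intro V.subspace_sum[OF fiber_subspace] adj_in)
    show "h' y v \<in> fiber \<xi> y" using v by (rule h_in)
    fix w assume w: "w \<in> fiber \<xi> y"
    obtain s where s: "s \<in> sections \<xi>" "s y = v" using section_through[OF v] .
    obtain t where t: "t \<in> sections \<xi>" "t y = w" using section_through[OF w] .
    let ?s = "\<lambda>y. m y (s (r y))" and ?t = "\<lambda>y. m y (t (r y))"
    note st = sections_refine[OF s(1)] sections_refine[OF t(1)]
    have "herm \<xi> y w (h' y v) = ip (M W1 t) (M W2 s) y"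
      using endo_of_adj(2)[OF M_Hom[OF W1] M_Hom[OF W2] s(1) t(1), of y] s t by (simp add: h'_def)
    also have "\<dots> = (\<Sum>i=1..q. ip (W1 ?t) (W2 ?s) (z i))"
      using xi_inner_compose_rti[OF Xi(1)[OF st(2)] Xi(2)[OF st(1)], of x] s t
      by (simp add: M_apply px z_def)
    \<comment> \<open>As \<open>r (z i) = y\<close>, the refined sections \<open>?s\<close> and
      \<open>?t\<close> take the values \<open>m (z i) v\<close> and \<open>m (z i) w\<close> at
      \<open>z i\<close>.\<close>
    also have "\<dots> = (\<Sum>i=1..q. herm \<xi> (z i) (m (z i) w) (h (z i) (m (z i) v)))"
      by (intro sum.cong) (simp_all add: endo_of_adj(2)[OF W1 W2 st, symmetric] h_def rz s t)
    also have "\<dots> = (\<Sum>i=1..q. herm \<xi> y w (bundle_map_adjoint \<xi> r m (z i) (h (z i) (m (z i) v))))"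
      using adj_eq[OF _ w] by (intro sum.cong) simp_all
    \<comment> \<open>Additivity of the metric over the sum is the rule for linear combinations with
      all coefficients 1.\<close>
    also have "\<dots> = herm \<xi> y w (R h y v)"
      unfolding Rh
      using linear_between_sum[OF herm_linear[OF w] V.vector_space_axioms fiber_subspace, of "{1..q}" _ "\<lambda>_. 1"] adj_in
      by simp
    finally show "herm \<xi> y w (R h y v) = herm \<xi> y w (h' y v)" by simp
  qed
  moreover have "R h y \<in> extensional (fiber \<xi> y)" "h' y \<in> extensional (fiber \<xi> y)"
    using h' by (auto simp: transfer_def bundle_End_def)
  ultimately have "R h y = h' y" by (intro extensionalityI)
  then show "R (endo_of \<xi> (adj W1 \<circ> W2)) y = endo_of \<xi> (adj (M W1) \<circ> M W2) y"
    by (simp add: h_def h'_def)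
qed

end

theorem theorem5p5:
  fixes G :: "('g, 'b) monoid_scheme"
    and act :: "'g \<Rightarrow> 'a::metric_space \<Rightarrow> 'a"
    and p :: "'a \<Rightarrow> 'x::metric_space"
    and A :: "'g \<Rightarrow> 'g"
    and rt :: "'a \<Rightarrow> 'a"
    and r :: "'x \<Rightarrow> 'x"
    and q :: nat
    and gs :: "nat \<Rightarrow> 'g"
    and \<xi> :: "('x, 'v::ab_group_add, 'd::finite) vbundle"
    and m :: "'x \<Rightarrow> 'v \<Rightarrow> 'v"
    and W1 W2 :: "('x \<Rightarrow> 'v) \<Rightarrow> ('a \<Rightarrow> complex)"
  defines "R \<equiv> transfer act p rt r q gs \<xi> m"
    and "M \<equiv> refine rt r \<xi> m"
    and "adj \<equiv> module_adjoint G act p \<xi>"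
  assumes "self_covering G act p A rt r q gs"
    and "lipschitz_vector_bundle \<xi>"
    and "hermitian_metric \<xi>"
    and "isometrically_trivial_pullback \<xi> p"
    and "lipschitz_bundle_map \<xi> r m"
    and "power_bounded \<xi> R"
    and "W1 \<in> Hom_S_Xi G act p \<xi>"
    and "W2 \<in> Hom_S_Xi G act p \<xi>"
  shows "R (endo_of \<xi> (adj W1 \<circ> W2)) = endo_of \<xi> (adj (M W1) \<circ> M W2) \<and>
    (M W1 = W1 \<and> M W2 = W2 \<longrightarrow>
      R (endo_of \<xi> (adj W1 \<circ> W2)) = endo_of \<xi> (adj W1 \<circ> W2) \<and>
      harmonic \<xi> R (endo_of \<xi> (adj W1 \<circ> W2)))"
proof -
  interpret self_covering G act p A rt r q gs by fact
  from \<open>isometrically_trivial_pullback \<xi> p\<close> obtain \<tau> :: "'a \<Rightarrow> 'v \<Rightarrow> complex ^ 'd" where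
    \<tau>: "\<forall>x. linear_between (scl \<xi>) (fiber \<xi> (p x)) (*s) UNIV (\<tau> x) \<and>
           bij_betw (\<tau> x) (fiber \<xi> (p x)) UNIV \<and>
           (\<forall>u\<in>fiber \<xi> (p x). \<forall>v\<in>fiber \<xi> (p x).
              herm \<xi> (p x) u v = (\<Sum>j\<in>UNIV. cnj (\<tau> x u $ j) * \<tau> x v $ j))"
      "homeomorphic_map (pullback \<xi> p) euclidean (\<lambda>(x, _, v). (x, \<tau> x v))"
    unfolding isometrically_trivial_pullback_def by blast
  interpret refinement_setting G act p A rt r q gs \<xi> \<tau> m
    by unfold_locales (use assms(5,6,8) \<tau> in blast)+
  have "R (endo_of \<xi> (adj W1 \<circ> W2)) = endo_of \<xi> (adj (M W1) \<circ> M W2)"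
    unfolding R_def M_def adj_def using assms(10,11) by (rule transfer_adj)
  \<comment> \<open>\<open>harmonic\<close> asks for membership in \<open>bundle_End\<close> besides
    the fixed point equation.\<close>
  moreover have "endo_of \<xi> (adj W1 \<circ> W2) \<in> bundle_End \<xi>"
    unfolding adj_def using assms(10,11) by (rule endo_of_adj(1))
  ultimately show ?thesis by (simp add: harmonic_def)
qed

end
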